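(* Let $k$ be a field of characteristic different from $2$ and $3$, let $a,d\in k$ be distinct and non-zero, and let $E: ax^2+y^2=1+dx^2y^2$. Let $P=(x,y)\in E(\overline{k})\setminus\{(0,1)\}$ and let $n\ge1$ be an integer. Then $P$ is an $n$-torsion point of $E$ if and only if $\tilde\psi_n(y)=0$.
   Context: The $\tilde\psi_n=\tilde\psi_n(y)$ are defined recursively in the field of rational functions in $y$ over $k$ (each is in fact a polynomial in $y$) by $\tilde\psi_0=0$, $\tilde\psi_1=1$, $\tilde\psi_2=y+1$, $\tilde\psi_3=-dy^4-2dy^3+2ay+a$, $\tilde\psi_4=-2y(y+1)(dy^4-a)$, $$\tilde\psi_{2r+1}=\begin{cases}\dfrac{4(a-d)(a-dy^2)^2\tilde\psi_{r+2}\tilde\psi_r^3}{(y+1)^2}-\tilde\psi_{r-1}\tilde\psi_{r+1}^3 & r\equiv0\pmod 4,\ r\ge4,\\[2mm] \tilde\psi_{r+2}\tilde\psi_r^3-\dfrac{4(a-dy^2)^2\tilde\psi_{r-1}\tilde\psi_{r+1}^3}{(y+1)^2} & r\equiv1\pmod 4,\ r\ge5,\\[2mm] \dfrac{4(a-dy^2)^2\tilde\psi_{r+2}\tilde\psi_r^3}{(y+1)^2}-\tilde\psi_{r-1}\tilde\psi_{r+1}^3 & r\equiv2\pmod 4,\ r\ge2,\\[2mm] \tilde\psi_{r+2}\tilde\psi_r^3-\dfrac{4(a-d)(a-dy^2)^2\tilde\psi_{r-1}\tilde\psi_{r+1}^3}{(y+1)^2} & r\equiv3\pmod 4,\ r\ge3,\end{cases}$$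 $$\tilde\psi_{2r}=\begin{cases}\dfrac{\tilde\psi_r}{y+1}\left(\tilde\psi_{r+2}\tilde\psi_{r-1}^2-\tilde\psi_{r-2}\tilde\psi_{r+1}^2\right) & r\equiv0,2\pmod 4,\ r\ge4,\\[2mm] \dfrac{\tilde\psi_r}{y+1}\left((a-d)\tilde\psi_{r+2}\tilde\psi_{r-1}^2-\tilde\psi_{r-2}\tilde\psi_{r+1}^2\right) & r\equiv1\pmod 4,\ r\ge5,\\[2mm] \dfrac{\tilde\psi_r}{y+1}\left(\tilde\psi_{r+2}\tilde\psi_{r-1}^2-(a-d)\tilde\psi_{r-2}\tilde\psi_{r+1}^2\right) & r\equiv3\pmod 4,\ r\ge3.\end{cases}$$ Group law: points on $E$ are added by $(x_1,y_1)+(x_2,y_2)=\left(\frac{x_1y_2+x_2y_1}{1+dx_1x_2y_1y_2},\frac{y_1y_2-ax_1x_2}{1-dx_1x_2y_1y_2}\right)$, with identity $(0,1)$ and $-(x,y)=(-x,y)$. This corresponds to the group law of the elliptic curve $W: v^2=u^3-\frac{a^2+14ad+d^2}{48}u-\frac{a^3-33a^2d-33ad^2+d^3}{864}$ with identity $\mathcal{O}$ (point at infinity) under the map $(x,y)\mapsto(u,v)$, $u=\frac{(5a-d)+(a-5d)y}{12(1-y)}$, $v=\frac{(a-d)(1+y)}{4x(1-y)}$ if $x(1-y)\ne0$, $(0,1)\mapsto\mathcal{O}$, $(0,-1)\mapsto\left(\frac{a+d}{6},0\right)$. A point $P\in E(\overline{k})$ is an $n$-torsion point if $[n]P=(0,1)$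 (its order divides $n$), meaning that the $n$-th multiple of its image in $W(\overline{k})$ is $\mathcal{O}$. *)

theory Defs
  imports
    "HOL-Algebra.Algebraic_Closure_Type"
    "HOL-Computational_Algebra.Polynomial_Factorial"
begin

section \<open>Twisted Edwards curves and their Weierstrass models\<close>

definition edwards_curve :: "'a::field \<Rightarrow> 'a \<Rightarrow> ('a \<times> 'a) set" where
  "edwards_curve a d = {(x, y). a * x^2 + y^2 = 1 + d * x^2 * y^2}"

datatype 'a wpoint = WInf | WPt 'a 'a

text \<open>The projective closure of \<open>v\<^sup>2 = u\<^sup>3 + A u + B\<close>; \<open>WInf\<close> is its point at infinity.\<close>

definition weierstrass_curve :: "'a::field \<Rightarrow> 'a \<Rightarrow> 'a wpoint set" where
  "weierstrass_curve A B = insert WInf {WPt u v | u v. v^2 = u^3 + A * u + B}"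

text \<open>
  Chord-and-tangent addition. The constant term \<open>B\<close> does not enter the formulas. On the curve,
  the tangent case is reached only if the two points coincide and \<open>v\<^sub>1 \<noteq> 0\<close>.
\<close>

fun weierstrass_add :: "'a::field \<Rightarrow> 'a wpoint \<Rightarrow> 'a wpoint \<Rightarrow> 'a wpoint" where
  "weierstrass_add A WInf Q = Q"
| "weierstrass_add A P WInf = P"
| "weierstrass_add A (WPt u1 v1) (WPt u2 v2) =
    (if u1 = u2 \<and> v1 = - v2 then WInf
     else
       let m = (if u1 = u2 then (3 * u1^2 + A) / (2 * v1) else (v2 - v1) / (u2 - u1));
           u3 = m^2 - u1 - u2
       in WPt u3 (m * (u1 - u3) - v1))"

primrec weierstrass_mult :: "'a::field \<Rightarrow> nat \<Rightarrow> 'a wpoint \<Rightarrow> 'a wpoint" where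
  "weierstrass_mult A 0 P = WInf"
| "weierstrass_mult A (Suc n) P = weierstrass_add A P (weierstrass_mult A n P)"

definition edwards_A :: "'a::field \<Rightarrow> 'a \<Rightarrow> 'a" where
  "edwards_A a d = - (a^2 + 14 * a * d + d^2) / 48"

definition edwards_B :: "'a::field \<Rightarrow> 'a \<Rightarrow> 'a" where
  "edwards_B a d = - (a^3 - 33 * a^2 * d - 33 * a * d^2 + d^3) / 864"

text \<open>
  On the curve with \<open>a \<noteq> d\<close>, the condition \<open>x (1 - y) = 0\<close> holds only at \<open>(0, 1)\<close> and
  \<open>(0, -1)\<close>, so the last branch is the image of \<open>(0, -1)\<close>.
\<close>

definition edwards_to_weierstrass :: "'a::field \<Rightarrow> 'a \<Rightarrow> 'a \<times> 'a \<Rightarrow> 'a wpoint" where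
  "edwards_to_weierstrass a d = (\<lambda>(x, y).
    if x * (1 - y) \<noteq> 0 then
      WPt (((5 * a - d) + (a - 5 * d) * y) / (12 * (1 - y)))
          ((a - d) * (1 + y) / (4 * x * (1 - y)))
    else if (x, y) = (0, 1) then WInf
    else WPt ((a + d) / 6) 0)"

lemma edwards_to_weierstrass_in_curve:
  fixes a d :: "'a::field"
  assumes two: "(2::'a) \<noteq> 0" and three: "(3::'a) \<noteq> 0"
    and P: "P \<in> edwards_curve a d"
  shows "edwards_to_weierstrass a d P \<in> weierstrass_curve (edwards_A a d) (edwards_B a d)"
proof -
  obtain x y where [simp]: "P = (x, y)" by (cases P)
  have E: "a * x^2 + y^2 = 1 + d * x^2 * y^2"
    using P by (simp add: edwards_curve_def)
  have num: "(48::'a) = 2 * 2 * 2 * 2 * 3" "(864::'a) = 2 * 2 * 2 * 2 * 2 * 3 * 3 * 3"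
    "(12::'a) = 2 * 2 * 3" "(6::'a) = 2 * 3" "(4::'a) = 2 * 2"
    "(108::'a) = 2 * 2 * 3 * 3 * 3"
    by simp_all
  have nz: "(48::'a) \<noteq> 0" "(864::'a) \<noteq> 0" "(12::'a) \<noteq> 0" "(6::'a) \<noteq> 0" "(4::'a) \<noteq> 0" "(108::'a) \<noteq> 0"
    using two three unfolding num mult_eq_0_iff by simp_all
  define \<alpha> where "\<alpha> = a^2 + 14 * a * d + d^2"
  define \<beta> where "\<beta> = a^3 - 33 * a^2 * d - 33 * a * d^2 + d^3"
  show ?thesis
  proof (cases "x * (1 - y) = 0")
    case True
    have "0 = (a + d)^3 / 216 + edwards_A a d * ((a + d) / 6) + edwards_B a d"
    proof -
      have "0 = 4 * (a + d)^3 - 3 * (\<alpha> * (a + d)) - \<beta>"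
        by (simp add: \<alpha>_def \<beta>_def algebra_simps power2_eq_square power3_eq_cube)
      then have "0 = (4 * (a + d)^3 - 3 * (\<alpha> * (a + d)) - \<beta>) / 864"
        by simp
      also have "\<dots> = (4 * (a + d)^3) / (4 * 216) - (3 * (\<alpha> * (a + d))) / (3 * 288) - \<beta> / 864"
        by (simp only: diff_divide_distrib) simp
      also have "\<dots> = (a + d)^3 / 216 - \<alpha> * (a + d) / 288 - \<beta> / 864"
        by (simp only: mult_divide_mult_cancel_left[OF nz(5)] mult_divide_mult_cancel_left[OF three])
      also have "\<dots> = (a + d)^3 / 216 + edwards_A a d * ((a + d) / 6) + edwards_B a d"
        unfolding edwards_A_def edwards_B_def \<alpha>_def[symmetric] \<beta>_def[symmetric] by simp
      finally show ?thesis .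
    qed
    then have "0^2 = ((a + d) / 6)^3 + edwards_A a d * ((a + d) / 6) + edwards_B a d"
      by (simp add: power_divide)
    then have "WPt ((a + d) / 6) 0 \<in> weierstrass_curve (edwards_A a d) (edwards_B a d)"
      unfolding weierstrass_curve_def by blast
    then show ?thesis
      using True by (auto simp: edwards_to_weierstrass_def weierstrass_curve_def)
  next
    case False
    then have nz': "x \<noteq> 0" "1 - y \<noteq> 0" by auto
    define t where "t = 1 - y"
    define N where "N = (5 * a - d) + (a - 5 * d) * y"
    have t: "t \<noteq> 0" using nz' by (simp add: t_def)
    have k1: "N^3 - 3 * (\<alpha> * N * t^2) - 2 * (\<beta> * t^3) = 108 * ((a - d)^2 * (1 + y) * (a - d * y^2))"
      unfolding N_def \<alpha>_def \<beta>_def t_def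
      by (simp add: algebra_simps power2_eq_square power3_eq_cube)
    have k2: "(1 + y) * t = x^2 * (a - d * y^2)"
    proof -
      have "x^2 * (a - d * y^2) = (a * x^2 + y^2) - y^2 - d * x^2 * y^2"
        by (simp add: algebra_simps)
      also have "\<dots> = (1 + y) * t"
        unfolding E t_def by (simp add: algebra_simps power2_eq_square)
      finally show ?thesis by simp
    qed
    have "((a - d) * (1 + y) / (4 * x * t))^2 = ((a - d) * (1 + y))^2 * t / (16 * (x^2 * t^3))"
      using t by (simp add: power_divide power_mult_distrib power2_eq_square power3_eq_cube mult_ac)
    also have "((a - d) * (1 + y))^2 * t = (a - d)^2 * (1 + y) * ((1 + y) * t)"
      by (simp add: power2_eq_square mult_ac)
    also have "\<dots> = x^2 * ((a - d)^2 * (1 + y) * (a - d * y^2))"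
      unfolding k2 by (simp add: mult_ac)
    also have "\<dots> / (16 * (x^2 * t^3)) = ((a - d)^2 * (1 + y) * (a - d * y^2)) / (16 * t^3)"
      using nz' by simp
    also have "\<dots> = (108 * ((a - d)^2 * (1 + y) * (a - d * y^2))) / (108 * (16 * t^3))"
      by (rule mult_divide_mult_cancel_left[OF nz(6), symmetric])
    also have "\<dots> = (N^3 - 3 * (\<alpha> * N * t^2) - 2 * (\<beta> * t^3)) / (1728 * t^3)"
      unfolding k1 by simp
    also have "\<dots> = N^3 / (1728 * t^3) - ((3 * t^2) * (\<alpha> * N)) / ((3 * t^2) * (576 * t))
        - ((2 * t^3) * \<beta>) / ((2 * t^3) * 864)"
      by (simp only: diff_divide_distrib) (simp add: power2_eq_square power3_eq_cube mult_ac)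
    also have "\<dots> = N^3 / (1728 * t^3) - (\<alpha> * N) / (576 * t) - \<beta> / 864"
    proof -
      have "3 * t^2 \<noteq> 0" "2 * t^3 \<noteq> 0" using two three t by simp_all
      then show ?thesis by (simp only: mult_divide_mult_cancel_left not_False_eq_True)
    qed
    also have "\<dots> = (N / (12 * t))^3 + edwards_A a d * (N / (12 * t)) + edwards_B a d"
      unfolding edwards_A_def edwards_B_def \<alpha>_def[symmetric] \<beta>_def[symmetric]
      by (simp add: power_divide power_mult_distrib)
    finally have "WPt (N / (12 * t)) ((a - d) * (1 + y) / (4 * x * t))
        \<in> weierstrass_curve (edwards_A a d) (edwards_B a d)"
      unfolding weierstrass_curve_def by blast
    then show ?thesis
      using False by (simp add: edwards_to_weierstrass_def t_def N_def)
  qed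
qed

text \<open>
  The Edwards addition formulas have zero denominators for some pairs of points, so multiples
  are formed on the Weierstrass model.
\<close>

definition edwards_torsion :: "'a::field \<Rightarrow> 'a \<Rightarrow> nat \<Rightarrow> 'a \<times> 'a \<Rightarrow> bool" where
  "edwards_torsion a d n P \<longleftrightarrow>
    weierstrass_mult (edwards_A a d) n (edwards_to_weierstrass a d P) = WInf"


section \<open>The polynomials \<open>\<psi>\<^sub>n\<close>\<close>

definition ratvar :: "'a::field poly fract" where
  "ratvar = to_fract [:0, 1:]"

definition ratconst :: "'a::field \<Rightarrow> 'a poly fract" where
  "ratconst c = to_fract [:c:]"

lemma edwards_psi_termination_aux:
  "r = n div 2 \<Longrightarrow> n \<noteq> 0 \<Longrightarrow> n \<noteq> 1 \<Longrightarrow> n \<noteq> 2 \<Longrightarrow> n \<noteq> 3 \<Longrightarrow> n \<noteq> 4 \<Longrightarrow>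
    r - 2 < n \<and> r - 1 < n \<and> r < n \<and> r + 1 < n \<and> r + 2 < (n::nat)"
  by auto

function edwards_psi :: "'a::field \<Rightarrow> 'a \<Rightarrow> nat \<Rightarrow> 'a poly fract" (\<open>\<psi>\<close>) where
  "\<psi> a d n =
    (let y = ratvar; A = ratconst a; D = ratconst d; r = n div 2 in
     if n = 0 then 0
     else if n = 1 then 1
     else if n = 2 then y + 1
     else if n = 3 then - D * y^4 - 2 * D * y^3 + 2 * A * y + A
     else if n = 4 then - 2 * y * (y + 1) * (D * y^4 - A)
     else if odd n then
       (if r mod 4 = 0 then
          4 * (A - D) * (A - D * y^2)^2 * \<psi> a d (r + 2) * \<psi> a d r ^ 3 / (y + 1)^2
            - \<psi> a d (r - 1) * \<psi> a d (r + 1) ^ 3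
        else if r mod 4 = 1 then
          \<psi> a d (r + 2) * \<psi> a d r ^ 3
            - 4 * (A - D * y^2)^2 * \<psi> a d (r - 1) * \<psi> a d (r + 1) ^ 3 / (y + 1)^2
        else if r mod 4 = 2 then
          4 * (A - D * y^2)^2 * \<psi> a d (r + 2) * \<psi> a d r ^ 3 / (y + 1)^2
            - \<psi> a d (r - 1) * \<psi> a d (r + 1) ^ 3
        else
          \<psi> a d (r + 2) * \<psi> a d r ^ 3
            - 4 * (A - D) * (A - D * y^2)^2 * \<psi> a d (r - 1) * \<psi> a d (r + 1) ^ 3 / (y + 1)^2)
     else
       (if r mod 4 = 0 \<or> r mod 4 = 2 then
          \<psi> a d r / (y + 1) *
            (\<psi> a d (r + 2) * \<psi> a d (r - 1) ^ 2 - \<psi> a d (r - 2) * \<psi> a d (r + 1) ^ 2)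
        else if r mod 4 = 1 then
          \<psi> a d r / (y + 1) *
            ((A - D) * \<psi> a d (r + 2) * \<psi> a d (r - 1) ^ 2 - \<psi> a d (r - 2) * \<psi> a d (r + 1) ^ 2)
        else
          \<psi> a d r / (y + 1) *
            (\<psi> a d (r + 2) * \<psi> a d (r - 1) ^ 2 - (A - D) * \<psi> a d (r - 2) * \<psi> a d (r + 1) ^ 2)))"
  by pat_completeness auto
termination
  by (relation "measure (\<lambda>(a, d, n). n)", simp)
    (drule (5) edwards_psi_termination_aux, simp only: in_measure prod.case)+

declare edwards_psi.simps [simp del]

lemma edwards_psi_initial:
  "\<psi> a d 0 = 0"
  "\<psi> a d 1 = 1"
  "\<psi> a d 2 = ratvar + 1"
  "\<psi> a d 3 = - ratconst d * ratvar^4 - 2 * ratconst d * ratvar^3 + 2 * ratconst a * ratvar + ratconst a"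
  "\<psi> a d 4 = - 2 * ratvar * (ratvar + 1) * (ratconst d * ratvar^4 - ratconst a)"
  by (subst edwards_psi.simps; simp add: Let_def)+

lemma edwards_psi_polynomial_aux:
  "\<exists>p. \<psi> a d n = to_fract (if even n then [:1, 1:] * p else p)"
proof (induction n rule: less_induct)
  case (less n)
  define Y :: "'a poly fract" where "Y = to_fract [:1, 1:]"
  have Y: "ratvar + 1 = Y" "Y \<noteq> 0"
    by (simp_all add: Y_def ratvar_def one_pCons flip: to_fract_add to_fract_1)
  define T :: "'a poly fract set" where "T = range to_fract"
  have T_add: "u + v \<in> T" and T_diff: "u - v \<in> T" and T_mult: "u * v \<in> T"
    if "u \<in> T" "v \<in> T" for u v
    using that by (auto simp: T_def simp flip: to_fract_add to_fract_diff to_fract_mult)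
  have T_uminus: "- u \<in> T" if "u \<in> T" for u
    using that by (auto simp: T_def simp flip: to_fract_uminus)
  have T_1: "1 \<in> T"
    unfolding T_def by (metis to_fract_1 rangeI)
  have T_0: "0 \<in> T"
    unfolding T_def by (metis to_fract_0 rangeI)
  have T_power: "u ^ m \<in> T" if "u \<in> T" for u m
    by (induction m) (simp_all add: T_1 T_mult that)
  have T_numeral: "numeral m \<in> T" for m
    by (induction m) (simp_all only: numeral.simps T_1 T_add)
  have T_base: "ratvar \<in> T" "ratconst c \<in> T" "Y \<in> T" for c
    by (simp_all add: T_def ratvar_def ratconst_def Y_def)
  note T_intros = T_add T_diff T_mult T_uminus T_0 T_1 T_power T_numeral T_base
  have IH: "\<psi> a d m \<in> T" if "m < n" for m
    using less.IH[OF that] by (auto simp: T_def)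
  have IH_even: "\<exists>q\<in>T. \<psi> a d m = Y * q" if lt: "m < n" and ev: "even m" for m
  proof -
    obtain p where "\<psi> a d m = to_fract ([:1, 1:] * p)"
      using less.IH[OF lt] ev by auto
    then have "\<psi> a d m = Y * to_fract p" by (simp only: to_fract_mult Y_def)
    then show ?thesis by (auto simp: T_def)
  qed
  have goal: ?case if ev: "even n \<Longrightarrow> \<psi> a d n / Y \<in> T" and od: "odd n \<Longrightarrow> \<psi> a d n \<in> T"
  proof (cases "even n")
    case True
    then obtain p where "\<psi> a d n / Y = to_fract p" using ev unfolding T_def by blast
    then have "\<psi> a d n = to_fract ([:1, 1:] * p)"
      using Y(2) by (simp only: to_fract_mult flip: Y_def) (simp add: field_simps)
    with True show ?thesis by auto
  qed (use od in \<open>auto simp: T_def\<close>)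
  define r where "r = n div 2"
  consider "n < 5" | "n \<ge> 5" "odd n" "even r" | "n \<ge> 5" "odd n" "odd r"
    | "n \<ge> 5" "even n" "even r" | "n \<ge> 5" "even n" "odd r"
    by linarith
  then show ?case
  proof cases
    case 1
    then consider "n = 0" | "n = 1" | "n = 2" | "n = 3" | "n = 4" by linarith
    then have "if even n then \<psi> a d n / Y \<in> T else \<psi> a d n \<in> T"
      by cases (use Y(2) in \<open>simp_all add: edwards_psi_initial
        edwards_psi_initial(2)[simplified] Y(1) T_intros\<close>)
    then show ?thesis by (intro goal) (simp_all split: if_splits)
  next
    case 2
    then have "r < n" "r + 2 < n" "r - 1 < n" "r + 1 < n" by (auto simp: r_def)
    obtain q where q: "q \<in> T" "\<psi> a d r = Y * q" using IH_even 2 \<open>r < n\<close> by blast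
    have red: "u * (Y * q)^3 / Y^2 = u * (Y * q^3)" for u
      using Y(2) by (simp add: power2_eq_square power3_eq_cube)
    have "r mod 4 = 0 \<or> r mod 4 = 2" using \<open>even r\<close> by presburger
    then have "\<psi> a d n \<in> T"
    proof
      assume "r mod 4 = 0"
      then have "\<psi> a d n = 4 * (ratconst a - ratconst d) * (ratconst a - ratconst d * ratvar^2)^2
          * \<psi> a d (r + 2) * (Y * q^3) - \<psi> a d (r - 1) * \<psi> a d (r + 1) ^ 3"
        using 2 by (subst edwards_psi.simps) (simp add: Let_def Y(1) q red flip: r_def)
      then show ?thesis
        using \<open>r + 2 < n\<close> \<open>r - 1 < n\<close> \<open>r + 1 < n\<close> q(1) by (simp only:) (intro T_intros IH)
    next
      assume "r mod 4 = 2"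
      then have "\<psi> a d n = 4 * (ratconst a - ratconst d * ratvar^2)^2
          * \<psi> a d (r + 2) * (Y * q^3) - \<psi> a d (r - 1) * \<psi> a d (r + 1) ^ 3"
        using 2 by (subst edwards_psi.simps) (simp add: Let_def Y(1) q red flip: r_def)
      then show ?thesis
        using \<open>r + 2 < n\<close> \<open>r - 1 < n\<close> \<open>r + 1 < n\<close> q(1) by (simp only:) (intro T_intros IH)
    qed
    with 2 show ?thesis by (intro goal) auto
  next
    case 3
    then have "r < n" "r + 2 < n" "r - 1 < n" "r + 1 < n" by (auto simp: r_def)
    obtain q where q: "q \<in> T" "\<psi> a d (r + 1) = Y * q"
      using IH_even[of "r + 1"] 3 \<open>r + 1 < n\<close> by auto
    have red: "u * (Y * q)^3 / Y^2 = u * (Y * q^3)" for u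
      using Y(2) by (simp add: power2_eq_square power3_eq_cube)
    have "r mod 4 = 1 \<or> r mod 4 = 3" using \<open>odd r\<close> by presburger
    then have "\<psi> a d n \<in> T"
    proof
      assume "r mod 4 = 1"
      then have "\<psi> a d n = \<psi> a d (r + 2) * \<psi> a d r ^ 3
          - 4 * (ratconst a - ratconst d * ratvar^2)^2 * \<psi> a d (r - 1) * (Y * q^3)"
        using 3 q by (subst edwards_psi.simps) (simp add: Let_def Y(1) red flip: r_def)
      then show ?thesis
        using \<open>r + 2 < n\<close> \<open>r - 1 < n\<close> \<open>r < n\<close> q(1) by (simp only:) (intro T_intros IH)
    next
      assume "r mod 4 = 3"
      then have "\<psi> a d n = \<psi> a d (r + 2) * \<psi> a d r ^ 3
          - 4 * (ratconst a - ratconst d) * (ratconst a - ratconst d * ratvar^2)^2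
            * \<psi> a d (r - 1) * (Y * q^3)"
        using 3 q by (subst edwards_psi.simps) (simp add: Let_def Y(1) red flip: r_def)
      then show ?thesis
        using \<open>r + 2 < n\<close> \<open>r - 1 < n\<close> \<open>r < n\<close> q(1) by (simp only:) (intro T_intros IH)
    qed
    with 3 show ?thesis by (intro goal) auto
  next
    case 4
    then have lt: "r < n" "r + 2 < n" "r - 1 < n" "r + 1 < n" "r - 2 < n" by (auto simp: r_def)
    obtain q q1 q2 where q: "q \<in> T" "\<psi> a d r = Y * q" "q1 \<in> T" "\<psi> a d (r + 2) = Y * q1"
      "q2 \<in> T" "\<psi> a d (r - 2) = Y * q2"
      using IH_even[of r] IH_even[of "r + 2"] IH_even[of "r - 2"] 4 lt by auto
    have "r mod 4 = 0 \<or> r mod 4 = 2" using \<open>even r\<close> by presburger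
    then have "\<psi> a d n = \<psi> a d r / Y *
        (\<psi> a d (r + 2) * \<psi> a d (r - 1) ^ 2 - \<psi> a d (r - 2) * \<psi> a d (r + 1) ^ 2)"
      using 4 by (subst edwards_psi.simps) (simp add: Let_def Y(1) flip: r_def)
    also have "\<dots> / Y = q * (q1 * \<psi> a d (r - 1) ^ 2 - q2 * \<psi> a d (r + 1) ^ 2)"
      using Y(2) unfolding q by (simp add: field_simps)
    also have "\<dots> \<in> T" using lt q by (intro T_intros IH)
    finally show ?thesis using 4 by (intro goal) auto
  next
    case 5
    then have lt: "r < n" "r + 2 < n" "r - 1 < n" "r + 1 < n" "r - 2 < n" by (auto simp: r_def)
    obtain q1 q2 where q: "q1 \<in> T" "\<psi> a d (r + 1) = Y * q1" "q2 \<in> T" "\<psi> a d (r - 1) = Y * q2"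
      using IH_even[of "r + 1"] IH_even[of "r - 1"] 5 lt by auto
    obtain c1 c2 where c: "c1 \<in> T" "c2 \<in> T" and "\<psi> a d n = \<psi> a d r / Y *
        (c1 * \<psi> a d (r + 2) * \<psi> a d (r - 1) ^ 2 - c2 * \<psi> a d (r - 2) * \<psi> a d (r + 1) ^ 2)"
    proof (cases "r mod 4 = 1")
      case True
      show ?thesis
        by (rule that[of "ratconst a - ratconst d" 1], (intro T_intros)+, subst edwards_psi.simps)
          (use 5 True in \<open>simp add: Let_def Y(1) flip: r_def\<close>)
    next
      case False
      then have "r mod 4 = 3" using \<open>odd r\<close> by presburger
      then show ?thesis
        by (intro that[of 1 "ratconst a - ratconst d"], (intro T_intros)+, subst edwards_psi.simps)
          (use 5 in \<open>simp add: Let_def Y(1) flip: r_def\<close>)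
    qed
    note this(3)
    also have "\<psi> a d r / Y * (c1 * \<psi> a d (r + 2) * \<psi> a d (r - 1) ^ 2
          - c2 * \<psi> a d (r - 2) * \<psi> a d (r + 1) ^ 2) / Y
        = \<psi> a d r * (c1 * \<psi> a d (r + 2) * q2 ^ 2 - c2 * \<psi> a d (r - 2) * q1 ^ 2)"
      using Y(2) unfolding q by (simp add: field_simps power2_eq_square)
    also have "\<dots> \<in> T" using lt q c by (intro T_intros IH)
    finally show ?thesis using 5 by (intro goal) auto
  qed
qed

lemma edwards_psi_polynomial: "\<exists>!p. to_fract p = \<psi> a d n"
  using edwards_psi_polynomial_aux[of a d n] by (metis to_fract_eq_iff)

definition edwards_psi_poly :: "'a::field \<Rightarrow> 'a \<Rightarrow> nat \<Rightarrow> 'a poly" where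
  "edwards_psi_poly a d n = (THE p. to_fract p = \<psi> a d n)"

lemma to_fract_edwards_psi_poly: "to_fract (edwards_psi_poly a d n) = \<psi> a d n"
  unfolding edwards_psi_poly_def by (rule theI') (rule edwards_psi_polynomial)

end

theory Submission
  imports Defs
begin

text \<open>
  Let \<open>s\<^sub>n\<close> be the value of the classical \<open>n\<close>-th division polynomial at a point \<open>P = (u, v)\<close> of a
  Weierstrass curve with \<open>v \<noteq> 0\<close>. The abscissa of \<open>nP\<close> is \<open>u - s\<^sub>n\<^sub>+\<^sub>1 s\<^sub>n\<^sub>-\<^sub>1 / s\<^sub>n\<^sup>2\<close>, and \<open>nP\<close> is the point
  at infinity if and only if \<open>s\<^sub>n = 0\<close>. For the image of a point \<open>(x, y)\<close> of the Edwards curve with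
  \<open>y \<noteq> -1\<close>, the numbers \<open>s\<^sub>n\<close> and \<open>\<psi>\<^sub>n(y)\<close> differ by a non-zero factor, a product of powers of
  \<open>a - d\<close>, \<open>2 (1 - y)\<close> and \<open>x\<close>: the recurrences for \<open>\<psi>\<^sub>n\<close> are the classical ones after this rescaling
  (\<open>eds_scaling\<close>, \<open>edwards_torsion_iff\<close>). The remaining point \<open>(0, -1)\<close> has order 2, and
  \<open>\<psi>\<^sub>n(-1)\<close> vanishes exactly for even \<open>n\<close>.

  The difficulty is that \<open>s\<^sub>n\<close> is defined by formulas that express \<open>s\<^sub>2\<^sub>r\<close> and \<open>s\<^sub>2\<^sub>r\<^sub>+\<^sub>1\<close> through terms near
  \<open>s\<^sub>r\<close>, while the multiples of \<open>P\<close> arise by adding \<open>P\<close> repeatedly. The step from \<open>nP\<close> to \<open>(n + 1)P\<close>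
  needs relations between a bounded number of consecutive terms. Two suffice: with
  \<open>x\<^sub>n = s\<^sub>n\<^sub>+\<^sub>1 s\<^sub>n\<^sub>-\<^sub>1 / s\<^sub>n\<^sup>2\<close>, consecutive pairs \<open>(x\<^sub>n, x\<^sub>n\<^sub>+\<^sub>1)\<close> lie on a fixed symmetric biquadratic curve,
  and \<open>x\<^sub>n\<^sub>+\<^sub>1 + x\<^sub>n\<^sub>-\<^sub>1\<close> is given by Vieta's formula on it. Given these, the coordinates of \<open>nP\<close> follow by
  induction with chord and tangent computations (\<open>weierstrass_mult_division_seq\<close>), and the
  sum relation ensures that the zeros of the sequence are isolated.

  That the doubling recursion implies the two relations is shown for a generic sequence. A sequence
  built from the sum relation satisfies Ward's identity for \<open>s\<^sub>m\<^sub>+\<^sub>n s\<^sub>m\<^sub>-\<^sub>n\<close>, hence the doubling formulas,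
  as long as no term is zero (\<open>doubling_of_somos\<close>). Over \<open>\<int>[c, \<beta>, \<gamma>]\<close> no term is zero, because a
  cuspidal cubic specialises \<open>s\<^sub>n\<close> to \<open>n\<close>. The relations are therefore identities over
  \<open>\<int>[c, \<beta>, \<gamma>]\<close>, and they specialise to all sequences, with zeros or without
  (\<open>division_seq_somos\<close>).
\<close>

section \<open>Sequences defined by doubling\<close>

definition twist :: "'a::comm_ring_1 \<Rightarrow> bool \<Rightarrow> 'a" where
  "twist \<delta> b = (if b then \<delta> else 1)"

lemma twist_simps [simp]: "twist \<delta> True = \<delta>" "twist \<delta> False = 1" "twist 1 b = 1"
  by (simp_all add: twist_def)

text \<open>
  One recursion serves both for the classical division polynomials and for \<open>\<psi>\<^sub>n\<close>. Every term of
  even index of an elliptic divisibility sequence is divisible by the second one; \<open>eds\<close> is the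
  sequence left after this factor is removed, so that its recursion is free of divisions, makes
  sense in every commutative ring and is preserved by ring morphisms. The parameter \<open>\<kappa>\<close> is what
  the removed factors leave behind (the fourth power of the second term in the classical case),
  and \<open>\<delta>\<close> is the factor that the Edwards recurrences carry in some classes of \<open>r\<close> modulo 4; for
  \<open>\<delta> = 1\<close> the recursion is the classical one.
\<close>

function eds :: "'a::comm_ring_1 \<Rightarrow> 'a \<Rightarrow> 'a \<Rightarrow> 'a \<Rightarrow> nat \<Rightarrow> 'a" where
  "eds \<delta> \<kappa> b3 b4 n =
    (let r = n div 2 in
     if n = 0 then 0 else if n = 1 then 1 else if n = 2 then 1
     else if n = 3 then b3 else if n = 4 then b4
     else if odd n then
       (if even r then
          twist \<delta> (r mod 4 = 0) * \<kappa> * eds \<delta> \<kappa> b3 b4 (r + 2) * eds \<delta> \<kappa> b3 b4 r ^ 3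
            - eds \<delta> \<kappa> b3 b4 (r - 1) * eds \<delta> \<kappa> b3 b4 (r + 1) ^ 3
        else
          eds \<delta> \<kappa> b3 b4 (r + 2) * eds \<delta> \<kappa> b3 b4 r ^ 3
            - twist \<delta> (r mod 4 = 3) * \<kappa> * eds \<delta> \<kappa> b3 b4 (r - 1) * eds \<delta> \<kappa> b3 b4 (r + 1) ^ 3)
     else
       eds \<delta> \<kappa> b3 b4 r *
         (twist \<delta> (r mod 4 = 1) * eds \<delta> \<kappa> b3 b4 (r + 2) * eds \<delta> \<kappa> b3 b4 (r - 1) ^ 2
           - twist \<delta> (r mod 4 = 3) * eds \<delta> \<kappa> b3 b4 (r - 2) * eds \<delta> \<kappa> b3 b4 (r + 1) ^ 2))"
  by pat_completeness auto
termination
  by (relation "measure (\<lambda>(\<delta>, \<kappa>, b3, b4, n). n)") auto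

declare eds.simps [simp del]

lemma eds_initial [simp]:
  "eds \<delta> \<kappa> b3 b4 0 = 0" "eds \<delta> \<kappa> b3 b4 1 = 1" "eds \<delta> \<kappa> b3 b4 (Suc 0) = 1"
  "eds \<delta> \<kappa> b3 b4 2 = 1" "eds \<delta> \<kappa> b3 b4 3 = b3" "eds \<delta> \<kappa> b3 b4 4 = b4"
  by (subst eds.simps; simp)+

lemma eds_odd_even:
  assumes "r \<ge> 2" "even r"
  shows "eds \<delta> \<kappa> b3 b4 (2 * r + 1) =
    twist \<delta> (r mod 4 = 0) * \<kappa> * eds \<delta> \<kappa> b3 b4 (r + 2) * eds \<delta> \<kappa> b3 b4 r ^ 3
      - eds \<delta> \<kappa> b3 b4 (r - 1) * eds \<delta> \<kappa> b3 b4 (r + 1) ^ 3"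
  using assms by (subst eds.simps) (simp add: Let_def)

lemma eds_odd_odd:
  assumes "r \<ge> 2" "odd r"
  shows "eds \<delta> \<kappa> b3 b4 (2 * r + 1) =
    eds \<delta> \<kappa> b3 b4 (r + 2) * eds \<delta> \<kappa> b3 b4 r ^ 3
      - twist \<delta> (r mod 4 = 3) * \<kappa> * eds \<delta> \<kappa> b3 b4 (r - 1) * eds \<delta> \<kappa> b3 b4 (r + 1) ^ 3"
  using assms by (subst eds.simps) (simp add: Let_def)

lemma eds_even:
  assumes "r \<ge> 3"
  shows "eds \<delta> \<kappa> b3 b4 (2 * r) = eds \<delta> \<kappa> b3 b4 r *
    (twist \<delta> (r mod 4 = 1) * eds \<delta> \<kappa> b3 b4 (r + 2) * eds \<delta> \<kappa> b3 b4 (r - 1) ^ 2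
      - twist \<delta> (r mod 4 = 3) * eds \<delta> \<kappa> b3 b4 (r - 2) * eds \<delta> \<kappa> b3 b4 (r + 1) ^ 2)"
  using assms by (subst eds.simps) (simp add: Let_def)

lemma eds_induct [case_names init odd even]:
  assumes "\<And>n. n \<in> {0, 1, 2, 3, 4} \<Longrightarrow> P n"
    and odd: "\<And>r. r \<ge> 2 \<Longrightarrow> P (r - 1) \<Longrightarrow> P r \<Longrightarrow> P (r + 1) \<Longrightarrow> P (r + 2) \<Longrightarrow> P (2 * r + 1)"
    and even: "\<And>r. r \<ge> 3 \<Longrightarrow> P (r - 2) \<Longrightarrow> P (r - 1) \<Longrightarrow> P r \<Longrightarrow> P (r + 1) \<Longrightarrow> P (r + 2) \<Longrightarrow> P (2 * r)"
  shows "P (n :: nat)"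
proof (induction n rule: less_induct)
  case (less n)
  consider "n \<in> {0, 1, 2, 3, 4}" | r where "r \<ge> 2" "n = 2 * r + 1" | r where "r \<ge> 3" "n = 2 * r"
  proof (cases "n < 5")
    case True
    then have "n \<in> {0, 1, 2, 3, 4}" by auto
    then show ?thesis using that by blast
  next
    case False
    then show ?thesis using that(2,3)[of "n div 2"] by (cases "even n") auto
  qed
  then show ?case
  proof cases
    case (2 r)
    then show ?thesis using odd[of r] less.IH by auto
  next
    case (3 r)
    then show ?thesis using even[of r] less.IH by auto
  qed (use assms in auto)
qed

section \<open>Ring morphisms and specialisation\<close>

text \<open>
  Both the evaluation of \<open>\<psi>\<^sub>n\<close> at a point and the passage from generic to concrete parameters are
  ring morphisms between types, and both act on a sequence through its parameters only.
\<close>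

locale ring_morphism =
  fixes h :: "'a::comm_ring_1 \<Rightarrow> 'b::comm_ring_1"
  assumes one [simp]: "h 1 = 1"
    and add [simp]: "h (p + q) = h p + h q"
    and mult [simp]: "h (p * q) = h p * h q"
begin

lemma zero [simp]: "h 0 = 0"
  using add[of 0 0] by simp

lemma uminus [simp]: "h (- p) = - h p"
  using add[of p "- p"] by (simp add: eq_neg_iff_add_eq_0 add.commute)

lemma diff [simp]: "h (p - q) = h p - h q"
  using add[of p "- q"] by simp

lemma power [simp]: "h (p ^ n) = h p ^ n"
  by (induction n) auto

lemma numeral [simp]: "h (numeral k) = numeral k"
  by (induction k) (simp_all only: numeral.simps add one)

lemma twist_image: "h (twist \<delta> b) = twist (h \<delta>) b"
  by (simp add: twist_def)

lemma eds_image: "h (eds \<delta> \<kappa> b3 b4 n) = eds (h \<delta>) (h \<kappa>) (h b3) (h b4) n"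
proof (induction n rule: eds_induct)
  case (odd r)
  then show ?case
    by (cases "even r") (simp_all only: eds_odd_even eds_odd_odd diff mult power twist_image not_False_eq_True)
next
  case (even r)
  then show ?case
    by (simp only: eds_even diff mult power twist_image)
qed auto

lemma eval_morphism: "ring_morphism (\<lambda>p. poly (map_poly h p) x)"
proof
  have hp: "map_poly h (pCons c p) = pCons (h c) (map_poly h p)" for c p
    by (rule map_poly_pCons) simp
  show "poly (map_poly h 1) x = 1"
    by (simp add: one_pCons hp)
  show add_eval: "poly (map_poly h (p + q)) x = poly (map_poly h p) x + poly (map_poly h q) x" for p q
    by (induction p q rule: poly_induct2) (simp_all add: hp algebra_simps)
  have smult_eval: "poly (map_poly h (smult c q)) x = h c * poly (map_poly h q) x" for c q
    by (induction q) (simp_all add: hp algebra_simps)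
  show "poly (map_poly h (p * q)) x = poly (map_poly h p) x * poly (map_poly h q) x" for p q
    by (induction p) (simp_all add: hp add_eval smult_eval algebra_simps)
qed

lemma eval_const [simp]: "poly (map_poly h [:c:]) x = h c"
  by (simp add: map_poly_pCons)

lemma eval_var [simp]: "poly (map_poly h [:0, 1:]) x = x"
  by (simp add: map_poly_pCons)

end

section \<open>Relations of bounded index span and the doubling formulas\<close>

text \<open>
  With \<open>x\<^sub>n = s\<^sub>n\<^sub>+\<^sub>1 s\<^sub>n\<^sub>-\<^sub>1 / s\<^sub>n\<^sup>2\<close>, this is \<open>x\<^sub>n\<^sup>2 (x\<^sub>n\<^sub>+\<^sub>1 + x\<^sub>n\<^sub>-\<^sub>1) = \<gamma> x\<^sub>n - c\<^sup>2\<close> for \<open>n = m + 2\<close>, cleared of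
  denominators. On an elliptic curve \<open>x\<^sub>n\<close> is the abscissa of \<open>P\<close> minus that of \<open>nP\<close>, and the
  relation expresses the sum of the abscissas of \<open>nP + P\<close> and \<open>nP - P\<close> through the abscissa
  of \<open>nP\<close>.
\<close>

definition somos_sum :: "'a::comm_ring_1 \<Rightarrow> 'a \<Rightarrow> (nat \<Rightarrow> 'a) \<Rightarrow> nat \<Rightarrow> bool" where
  "somos_sum c \<gamma> s m \<longleftrightarrow>
    s (m + 1)^2 * s (m + 4) + s (m + 3)^2 * s m
      = \<gamma> * s (m + 1) * s (m + 2) * s (m + 3) - c^2 * s (m + 2)^3"

text \<open>
  In the same notation, the symmetric biquadratic curve
  \<open>x\<^sup>2 x'\<^sup>2 - \<gamma> x x' + c\<^sup>2 (x + x') = \<beta>\<close> passes through \<open>(x\<^sub>n, x\<^sub>n\<^sub>+\<^sub>1)\<close> for \<open>n = m + 1\<close>. The two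
  neighbours of \<open>x\<^sub>n\<close> are the two roots of the quadratic equation that \<open>x\<^sub>n\<close> determines, and
  \<open>somos_sum\<close> is Vieta's formula for their sum.
\<close>

definition somos_biquadratic :: "'a::comm_ring_1 \<Rightarrow> 'a \<Rightarrow> 'a \<Rightarrow> (nat \<Rightarrow> 'a) \<Rightarrow> nat \<Rightarrow> bool" where
  "somos_biquadratic c \<beta> \<gamma> s m \<longleftrightarrow>
    (s m * s (m + 3))^2 - \<gamma> * s m * s (m + 1) * s (m + 2) * s (m + 3)
      + c^2 * (s m * s (m + 2)^3 + s (m + 3) * s (m + 1)^3)
    = \<beta> * s (m + 1)^2 * s (m + 2)^2"

text \<open>
  For a sequence that starts with \<open>0, 1, c\<close>, the sum relation forces Ward's identity
  \<open>t\<^sub>m\<^sub>+\<^sub>n t\<^sub>m\<^sub>-\<^sub>n = t\<^sub>m\<^sup>2 t\<^sub>n\<^sup>2 (x\<^sub>m - x\<^sub>n)\<close>, of which the doubling formulas are the cases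
  \<open>(m, n) = (r + 1, r)\<close> and \<open>(r + 1, r - 1)\<close>. The biquadratic expression is a first integral of
  the recursion: two consecutive values of it differ by a multiple of the sum relation. Together
  the two give the product \<open>x\<^sub>n\<^sub>+\<^sub>1 x\<^sub>n\<^sub>-\<^sub>1\<close> as well. Ward's identity then follows by induction on \<open>n\<close>,
  because \<open>x\<^sub>m\<^sup>2 (x\<^sub>m\<^sub>+\<^sub>1 - x\<^sub>n) (x\<^sub>m\<^sub>-\<^sub>1 - x\<^sub>n)\<close> turns out to be symmetric in \<open>m\<close> and \<open>n\<close>.

  Everything is restricted to indices up to \<open>N\<close>, and \<open>t\<^sub>N\<close> itself may vanish: this is the form in
  which the lemma identifies the next term of a sequence of which only the earlier terms are known.
\<close>

lemma doubling_of_somos: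
  fixes t :: "nat \<Rightarrow> 'a::field"
  assumes t0: "t 0 = 0" and t1: "t 1 = 1" and t2: "t 2 = c"
    and N: "5 \<le> N" and nz: "\<And>k. 1 \<le> k \<Longrightarrow> k < N \<Longrightarrow> t k \<noteq> 0"
    and sum_rel: "\<And>m. m + 4 \<le> N \<Longrightarrow> somos_sum c \<gamma> t m"
  defines "x \<equiv> \<lambda>n. t (n + 1) * t (n - 1) / t n ^ 2"
  shows "\<And>m. m + 3 \<le> N \<Longrightarrow>
      x (m + 1)^2 * x (m + 2)^2 - \<gamma> * x (m + 1) * x (m + 2) + c^2 * (x (m + 1) + x (m + 2)) - t 3 = 0"
      (is "\<And>m. _ \<Longrightarrow> ?J m")
    and "\<And>r. N = 2 * r + 1 \<Longrightarrow> t N = t (r + 2) * t r ^ 3 - t (r - 1) * t (r + 1) ^ 3"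
    and "\<And>r. N = 2 * r \<Longrightarrow> c * t N = t r * (t (r + 2) * t (r - 1) ^ 2 - t (r - 2) * t (r + 1) ^ 2)"
proof -
  note S = sum_rel[unfolded somos_sum_def]
  have c: "c \<noteq> 0" using nz[of 2] N t2 by simp
  have xt: "t (n + 1) * t (n - 1) = x n * t n ^ 2" if "1 \<le> n" "n < N" for n
    using nz[OF that] by (simp add: x_def)
  have sum: "x (m + 2)^2 * (x (m + 3) + x (m + 1)) = \<gamma> * x (m + 2) - c^2" if "m + 4 \<le> N" for m
  proof -
    have nz': "t (m + 1) \<noteq> 0" "t (m + 2) \<noteq> 0" "t (m + 3) \<noteq> 0" using nz that by auto
    have "x (m + 2)^2 * (x (m + 3) + x (m + 1))
        = (t (m + 1)^2 * t (m + 4) + t (m + 3)^2 * t m) / t (m + 2) ^ 3"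
      using nz' by (simp add: x_def field_simps power2_eq_square power3_eq_cube numeral_eq_Suc)
    also have "\<dots> = \<gamma> * x (m + 2) - c^2"
      unfolding S[OF that] using nz'
      by (simp add: x_def field_simps power2_eq_square power3_eq_cube numeral_eq_Suc)
    finally show ?thesis .
  qed
  have x1: "x 1 = 0" by (simp add: x_def t0)
  have x2: "c^2 * x 2 = t 3" using c t1 by (simp add: x_def t2)
  show J: "?J m" if "m + 3 \<le> N" for m
    using that
  proof (induction m)
    case 0
    then show ?case using x1 x2 by (simp add: numeral_2_eq_2)
  next
    case (Suc m)
    let ?a = "x (m + 1)" and ?b = "x (m + 2)" and ?c = "x (m + 3)"
    have s: "?b^2 * (?c + ?a) = \<gamma> * ?b - c^2" using sum[of m] Suc.prems by simp
    have j: "?a^2 * ?b^2 - \<gamma> * ?a * ?b + c^2 * (?a + ?b) - t 3 = 0"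
      using Suc by simp
    have "?b^2 * ?c^2 - \<gamma> * ?b * ?c + c^2 * (?b + ?c) - t 3
        = (?a^2 * ?b^2 - \<gamma> * ?a * ?b + c^2 * (?a + ?b) - t 3)
          + (?c - ?a) * (?b^2 * (?c + ?a) - (\<gamma> * ?b - c^2))"
      by (simp add: algebra_simps power2_eq_square)
    also have "\<dots> = 0" unfolding s j by simp
    finally show ?case by (simp add: eval_nat_numeral)
  qed
  have prod: "x (m + 2)^2 * x (m + 3) * x (m + 1) = c^2 * x (m + 2) - t 3" if "m + 4 \<le> N" for m
  proof -
    let ?a = "x (m + 1)" and ?b = "x (m + 2)" and ?c = "x (m + 3)"
    have j: "?a^2 * ?b^2 - \<gamma> * ?a * ?b + c^2 * (?a + ?b) - t 3 = 0"
      using J[of m] that by simp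
    have "?b^2 * ?c * ?a = ?a * (?b^2 * (?c + ?a)) - ?a^2 * ?b^2"
      by (simp add: algebra_simps power2_eq_square)
    also have "\<dots> = c^2 * ?b - t 3 - (?a^2 * ?b^2 - \<gamma> * ?a * ?b + c^2 * (?a + ?b) - t 3)"
      unfolding sum[OF that] by (simp add: algebra_simps)
    finally show ?thesis unfolding j by simp
  qed
  have rec: "x n ^ 2 * (x (n + 1) + x (n - 1)) = \<gamma> * x n - c^2"
      "x n ^ 2 * x (n + 1) * x (n - 1) = c^2 * x n - t 3" if "2 \<le> n" "n + 2 \<le> N" for n
  proof -
    have "n - 2 + 1 = n - 1" "n - 2 + 2 = n" "n - 2 + 3 = n + 1" using that by auto
    then show "x n ^ 2 * (x (n + 1) + x (n - 1)) = \<gamma> * x n - c^2"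
      "x n ^ 2 * x (n + 1) * x (n - 1) = c^2 * x n - t 3"
      using sum[of "n - 2"] prod[of "n - 2"] that by simp_all
  qed
  have E: "t (m + n) * t (m - n) = t m ^ 2 * t n ^ 2 * (x m - x n)"
    if "1 \<le> n" "n \<le> m" "m + n \<le> N" for m n
    using that
  proof (induction n arbitrary: m rule: less_induct)
    case (less n)
    consider "n = m" | "n = 1" "n < m" | "n = 2" "n < m" | "3 \<le> n" "n < m"
      using less.prems by linarith
    then show ?case
    proof cases
      case 1
      then show ?thesis by (simp add: t0)
    next
      case 2
      then show ?thesis using xt[of m] less.prems x1 t1 by simp
    next
      case 3
      define k where "k = m - 3"
      have m: "m = k + 3" using 3 k_def by simp
      have nz': "t (m - 1) \<noteq> 0" "t m \<noteq> 0" "t (m + 1) \<noteq> 0" using nz 3 less.prems by auto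
      have "t (m + 2) * t m * (t m * t (m - 2)) = x (m + 1) * t (m + 1)^2 * (x (m - 1) * t (m - 1)^2)"
        using xt[of "m + 1"] xt[of "m - 1"] 3 less.prems by (simp add: m numeral_eq_Suc)
      also have "\<dots> = x (m + 1) * x (m - 1) * (t (m + 1) * t (m - 1))^2"
        by (simp add: algebra_simps power2_eq_square)
      also have "\<dots> = x m ^ 2 * x (m + 1) * x (m - 1) * (t m ^ 2)^2"
        using xt[of m] 3 less.prems by (simp add: algebra_simps power2_eq_square)
      also have "x m ^ 2 * x (m + 1) * x (m - 1) = c^2 * x m - t 3"
        using rec[of m] 3 less.prems by simp
      also have "\<dots> = c^2 * (x m - x 2)"
        using x2 by (simp add: algebra_simps)
      finally have "(t (m + 2) * t (m - 2)) * t m ^ 2 = (t m ^ 2 * c^2 * (x m - x 2)) * t m ^ 2"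
        by (simp add: algebra_simps power2_eq_square)
      then show ?thesis using nz' 3 by (simp add: t2)
    next
      case 4
      define k where "k = n - 1"
      define l where "l = m - k"
      have k: "n = k + 1" "2 \<le> k" "m = k + l" "2 \<le> l" using 4 k_def l_def by auto
      have E1: "t (m + 1 + k) * t (m + 1 - k) = t (m + 1) ^ 2 * t k ^ 2 * (x (m + 1) - x k)"
        by (rule less.IH) (use k less.prems in auto)
      have E2: "t (m - 1 + k) * t (m - 1 - k) = t (m - 1) ^ 2 * t k ^ 2 * (x (m - 1) - x k)"
        by (rule less.IH) (use k less.prems in auto)
      have E3: "t (m + (k - 1)) * t (m - (k - 1)) = t m ^ 2 * t (k - 1) ^ 2 * (x m - x (k - 1))"
        by (rule less.IH) (use k less.prems in auto)
      have ix: "t (m + 1 + k) = t (m + n)" "t (m - 1 - k) = t (m - n)"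
        "t (m - (k - 1)) = t (m + 1 - k)" "t (m + (k - 1)) = t (m - 1 + k)"
        using k by (auto intro!: arg_cong[of _ _ t])
      have nz3: "t (m - 1 + k) * t (m + 1 - k) \<noteq> 0"
        using nz k less.prems by simp
      have sm: "x m ^ 2 * (x (m + 1) + x (m - 1)) = \<gamma> * x m - c^2"
        and pm: "x m ^ 2 * x (m + 1) * x (m - 1) = c^2 * x m - t 3"
        using rec[of m] k less.prems by simp_all
      have sk: "x k ^ 2 * (x (k + 1) + x (k - 1)) = \<gamma> * x k - c^2"
        and pk: "x k ^ 2 * x (k + 1) * x (k - 1) = c^2 * x k - t 3"
        using rec[of k] k less.prems by simp_all
      \<comment> \<open>By the sum and product rules at \<open>m\<close> and at \<open>k\<close>, both sides equal
        \<open>c\<^sup>2 (x\<^sub>m + x\<^sub>k) - t\<^sub>3 - \<gamma> x\<^sub>m x\<^sub>k + x\<^sub>m\<^sup>2 x\<^sub>k\<^sup>2\<close>.\<close>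
      have sym: "x m ^ 2 * ((x (m + 1) - x k) * (x (m - 1) - x k))
          = x k ^ 2 * ((x m - x (k + 1)) * (x m - x (k - 1)))"
      proof -
        have "x m ^ 2 * ((x (m + 1) - x k) * (x (m - 1) - x k))
            = x m ^ 2 * x (m + 1) * x (m - 1) - x k * (x m ^ 2 * (x (m + 1) + x (m - 1))) + x k ^ 2 * x m ^ 2"
          by (simp add: algebra_simps power2_eq_square)
        also have "\<dots> = x k ^ 2 * x (k + 1) * x (k - 1) - x m * (x k ^ 2 * (x (k + 1) + x (k - 1))) + x k ^ 2 * x m ^ 2"
          unfolding sm pm sk pk by (simp add: algebra_simps)
        also have "\<dots> = x k ^ 2 * ((x m - x (k + 1)) * (x m - x (k - 1)))"
          by (simp add: algebra_simps power2_eq_square)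
        finally show ?thesis .
      qed
      \<comment> \<open>The four indices \<open>m \<plusminus> 1 \<plusminus> k\<close> are also the four indices \<open>m \<plusminus> (k + 1)\<close>, \<open>m \<plusminus> (k - 1)\<close>; hence the
        identity for \<open>(m, k + 1)\<close> comes from those for \<open>(m \<plusminus> 1, k)\<close> after dividing by the one
        for \<open>(m, k - 1)\<close>.\<close>
      have "(t (m + n) * t (m - n)) * (t (m - 1 + k) * t (m + 1 - k))
          = (t (m + 1 + k) * t (m + 1 - k)) * (t (m - 1 + k) * t (m - 1 - k))"
        by (simp only: ix mult_ac)
      also have "\<dots> = (t (m + 1) * t (m - 1))^2 * t k ^ 4 * ((x (m + 1) - x k) * (x (m - 1) - x k))"
        unfolding E1 E2 by (simp add: algebra_simps eval_nat_numeral)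
      also have "\<dots> = t m ^ 4 * t k ^ 4 * (x m ^ 2 * ((x (m + 1) - x k) * (x (m - 1) - x k)))"
        using xt[of m] k less.prems by (simp add: power_mult_distrib mult_ac flip: power_mult)
      also have "\<dots> = t m ^ 4 * (x k * t k ^ 2)^2 * ((x m - x (k + 1)) * (x m - x (k - 1)))"
        unfolding sym by (simp add: power_mult_distrib mult_ac flip: power_mult)
      also have "x k * t k ^ 2 = t (k + 1) * t (k - 1)"
        using xt[of k] k less.prems by simp
      also have "t m ^ 4 * (t (k + 1) * t (k - 1))^2 * ((x m - x (k + 1)) * (x m - x (k - 1)))
          = (t m ^ 2 * t (k + 1) ^ 2 * (x m - x (k + 1))) * (t m ^ 2 * t (k - 1) ^ 2 * (x m - x (k - 1)))"
        by (simp add: algebra_simps eval_nat_numeral)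
      also have "\<dots> = (t m ^ 2 * t n ^ 2 * (x m - x n)) * (t (m - 1 + k) * t (m + 1 - k))"
        unfolding E3[symmetric] by (simp only: ix k(1))
      finally show ?thesis using nz3 by simp
    qed
  qed
  show "t N = t (r + 2) * t r ^ 3 - t (r - 1) * t (r + 1) ^ 3" if "N = 2 * r + 1" for r
  proof -
    have r: "2 \<le> r" using that N by simp
    have "t N = t (r + 1) ^ 2 * t r ^ 2 * (x (r + 1) - x r)"
      using E[of r "r + 1"] that r t1 by (simp add: mult_2)
    also have "\<dots> = t r ^ 2 * (x (r + 1) * t (r + 1) ^ 2) - t (r + 1) ^ 2 * (x r * t r ^ 2)"
      by (simp add: algebra_simps)
    also have "\<dots> = t r ^ 2 * (t (r + 2) * t r) - t (r + 1) ^ 2 * (t (r + 1) * t (r - 1))"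
      using xt[of r] xt[of "r + 1"] that r by (simp add: numeral_eq_Suc)
    finally show ?thesis by (simp add: eval_nat_numeral mult_ac)
  qed
  show "c * t N = t r * (t (r + 2) * t (r - 1) ^ 2 - t (r - 2) * t (r + 1) ^ 2)" if "N = 2 * r" for r
  proof -
    have r: "3 \<le> r" using that N by simp
    then have ix: "r + 1 + (r - 1) = N" "r + 1 - (r - 1) = 2" "r - 1 + 1 = r" "r - 1 - 1 = r - 2"
      "r + 1 + 1 = r + 2" "r + 1 - 1 = r"
      using that by auto
    have "c * t N = t (r + 1) ^ 2 * t (r - 1) ^ 2 * (x (r + 1) - x (r - 1))"
      using E[of "r - 1" "r + 1"] that r t2 unfolding ix by (simp add: mult.commute)
    also have "\<dots> = t (r - 1) ^ 2 * (x (r + 1) * t (r + 1) ^ 2) - t (r + 1) ^ 2 * (x (r - 1) * t (r - 1) ^ 2)"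
      by (simp add: algebra_simps)
    also have "\<dots> = t (r - 1) ^ 2 * (t (r + 2) * t r) - t (r + 1) ^ 2 * (t r * t (r - 2))"
      using xt[of "r - 1"] xt[of "r + 1"] that r unfolding ix by simp
    finally show ?thesis by (simp add: algebra_simps)
  qed
qed

section \<open>The division sequence and its generic case\<close>

text \<open>
  The values \<open>s\<^sub>n\<close> of the classical division polynomials at a point, parametrised by \<open>c = s\<^sub>2\<close>,
  \<open>\<beta> = s\<^sub>3\<close> and the number \<open>\<gamma>\<close> for which \<open>s\<^sub>4 = c (\<gamma> \<beta> - c\<^sup>4)\<close>. These three values are algebraically independent for a generic
  point on a generic curve, which is why identities may be proved over \<open>\<int>[c, \<beta>, \<gamma>]\<close>.
\<close>

definition division_seq :: "'a::comm_ring_1 \<Rightarrow> 'a \<Rightarrow> 'a \<Rightarrow> nat \<Rightarrow> 'a" where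
  "division_seq c \<beta> \<gamma> n = (if even n then c else 1) * eds 1 (c^4) \<beta> (\<gamma> * \<beta> - c^4) n"

lemma division_seq_initial [simp]:
  "division_seq c \<beta> \<gamma> 0 = 0" "division_seq c \<beta> \<gamma> 1 = 1" "division_seq c \<beta> \<gamma> (Suc 0) = 1"
  "division_seq c \<beta> \<gamma> 2 = c" "division_seq c \<beta> \<gamma> 3 = \<beta>"
  "division_seq c \<beta> \<gamma> 4 = c * (\<gamma> * \<beta> - c^4)"
  by (simp_all add: division_seq_def)

lemma division_seq_odd:
  assumes "r \<ge> 2"
  shows "division_seq c \<beta> \<gamma> (2 * r + 1) =
    division_seq c \<beta> \<gamma> (r + 2) * division_seq c \<beta> \<gamma> r ^ 3
      - division_seq c \<beta> \<gamma> (r - 1) * division_seq c \<beta> \<gamma> (r + 1) ^ 3"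
proof -
  let ?e = "eds 1 (c^4) \<beta> (\<gamma> * \<beta> - c^4)"
  have c4: "c * F * (c * G) ^ 3 = c ^ 4 * F * G ^ 3" for F G
    by (simp add: power_mult_distrib power3_eq_cube power4_eq_xxxx mult_ac)
  show ?thesis
  proof (cases "even r")
    case True
    then have par: "even (r + 2)" "odd (r - 1)" "odd (r + 1)" "odd (2 * r + 1)"
      using assms by auto
    have "?e (2 * r + 1) = c^4 * ?e (r + 2) * ?e r ^ 3 - ?e (r - 1) * ?e (r + 1) ^ 3"
      using eds_odd_even[OF assms True, of 1 "c^4"] by simp
    then show ?thesis
      by (simp only: division_seq_def par True if_True if_False c4 mult_1)
  next
    case False
    then have par: "odd (r + 2)" "even (r - 1)" "even (r + 1)" "odd (2 * r + 1)"
      using assms by auto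
    have "?e (2 * r + 1) = ?e (r + 2) * ?e r ^ 3 - c^4 * ?e (r - 1) * ?e (r + 1) ^ 3"
      using eds_odd_odd[OF assms False, of 1 "c^4"] by simp
    then show ?thesis
      by (simp only: division_seq_def par False if_True if_False c4 mult_1)
  qed
qed

lemma division_seq_even:
  assumes "r \<ge> 3"
  shows "c * division_seq c \<beta> \<gamma> (2 * r) = division_seq c \<beta> \<gamma> r *
    (division_seq c \<beta> \<gamma> (r + 2) * division_seq c \<beta> \<gamma> (r - 1) ^ 2
      - division_seq c \<beta> \<gamma> (r - 2) * division_seq c \<beta> \<gamma> (r + 1) ^ 2)"
proof -
  let ?e = "eds 1 (c^4) \<beta> (\<gamma> * \<beta> - c^4)"
  have e: "?e (2 * r) = ?e r * (?e (r + 2) * ?e (r - 1) ^ 2 - ?e (r - 2) * ?e (r + 1) ^ 2)"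
    using eds_even[OF assms, of 1 "c^4"] by simp
  have pow: "c * (c * (G * (F * E ^ 2 - F' * E' ^ 2))) = c * G * (c * F * E ^ 2 - c * F' * E' ^ 2)"
    "c * (c * (G * (F * E ^ 2 - F' * E' ^ 2))) = G * (F * (c * E) ^ 2 - F' * (c * E') ^ 2)" for E E' F F' G
    by (simp_all add: algebra_simps power2_eq_square)
  show ?thesis
  proof (cases "even r")
    case True
    then have par: "even (r + 2)" "odd (r - 1)" "odd (r + 1)" "even (r - 2)" "even (2 * r)"
      using assms by auto
    show ?thesis
      by (simp only: division_seq_def par True if_True if_False e pow(1) mult_1)
  next
    case False
    then have par: "odd (r + 2)" "even (r - 1)" "even (r + 1)" "odd (r - 2)" "even (2 * r)"
      using assms by auto
    show ?thesis
      by (simp only: division_seq_def par False if_True if_False e pow(2) mult_1)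
  qed
qed

lemma (in ring_morphism) division_seq_image:
  "h (division_seq c \<beta> \<gamma> n) = division_seq (h c) (h \<beta>) (h \<gamma>) n"
  by (simp add: division_seq_def eds_image)

text \<open>
  These parameters belong to the point \<open>(1, 1)\<close> of the cuspidal cubic \<open>v\<^sup>2 = u\<^sup>3\<close>, whose smooth points
  form an additive group. Over the integers no term of positive index vanishes, so none vanishes
  generically.
\<close>

lemma division_seq_cusp: "division_seq 2 3 6 n = (of_nat n :: int)"
proof (induction n rule: eds_induct)
  case (odd r)
  define k where "k = r - 2"
  have k: "r = k + 2" using odd.hyps by (simp add: k_def)
  have "int (2 * r + 1) = int (r + 2) * int r ^ 3 - int (r - 1) * int (r + 1) ^ 3"
    by (simp add: k algebra_simps power3_eq_cube)
  then show ?case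
    using division_seq_odd[OF odd.hyps, of 2 3 "6::int"] by (simp only: odd.IH)
next
  case (even r)
  define k where "k = r - 3"
  have k: "r = k + 3" "r - 2 = k + 1" "r - 1 = k + 2" using even.hyps by (simp_all add: k_def)
  have "2 * int (2 * r) = int r * (int (r + 2) * int (r - 1) ^ 2 - int (r - 2) * int (r + 1) ^ 2)"
    unfolding k(2,3) by (simp add: k(1) algebra_simps power2_eq_square)
  also have "\<dots> = 2 * division_seq 2 3 6 (2 * r)"
    using division_seq_even[OF even.hyps, of 2 3 "6::int"] by (simp only: even.IH)
  finally show ?case by simp
qed auto

text \<open>
  While no term vanishes, the sum relation can be solved for its last term. By strong induction the
  resulting value agrees with the sequence: the lemma on doubling formulas shows that it satisfies
  the recursion by which the sequence is defined.
\<close>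

lemma somos_of_nonvanishing:
  fixes c \<beta> \<gamma> :: "'a::field"
  defines "s \<equiv> division_seq c \<beta> \<gamma>"
  assumes nz: "\<And>n. n \<ge> 1 \<Longrightarrow> s n \<noteq> 0"
  shows "somos_sum c \<gamma> s m" and "somos_biquadratic c \<beta> \<gamma> s m"
proof -
  have c: "c \<noteq> 0" using nz[of 2] by (simp add: s_def)
  have s_init: "s 0 = 0" "s 1 = 1" "s 2 = c" "s 3 = \<beta>" "s 4 = c * (\<gamma> * \<beta> - c^4)"
    by (simp_all add: s_def)
  have sum: "somos_sum c \<gamma> s m" for m
  proof (induction m rule: less_induct)
    case (less m)
    show ?case
    proof (cases "m = 0")
      case True
      then show ?thesis
        using s_init by (simp add: somos_sum_def numeral_2_eq_2 algebra_simps eval_nat_numeral)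
    next
      case False
      define N where "N = m + 4"
      define T where "T = (\<gamma> * s (m + 1) * s (m + 2) * s (m + 3) - c^2 * s (m + 2)^3
        - s (m + 3)^2 * s m) / s (m + 1)^2"
      define t where "t k = (if k < N then s k else T)" for k
      have tS: "somos_sum c \<gamma> t k" if k: "k + 4 \<le> N" for k
      proof (cases "k = m")
        case True
        then show ?thesis
          using nz[of "m + 1"] by (simp add: somos_sum_def t_def N_def T_def)
      next
        case False
        then have "k < m" using k by (simp add: N_def)
        then show ?thesis using less.IH[of k] by (simp add: t_def N_def somos_sum_def)
      qed
      have N5: "5 \<le> N" using False by (simp add: N_def)
      have t_init: "t 0 = 0" "t 1 = 1" "t 2 = c"
        using N5 s_init by (simp_all add: t_def)
      have tnz: "t k \<noteq> 0" if "1 \<le> k" "k < N" for k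
        using that nz by (simp add: t_def)
      note dbl = doubling_of_somos(2,3)[of t c N \<gamma>, OF t_init N5 tnz tS]
      have "t N = s N"
      proof (cases "odd N")
        case True
        then obtain r where r: "N = 2 * r + 1" by (elim oddE)
        have "t N = t (r + 2) * t r ^ 3 - t (r - 1) * t (r + 1) ^ 3"
          by (rule dbl(1)) (use r in auto)
        also have "\<dots> = s (2 * r + 1)"
          unfolding s_def using r N5 by (subst division_seq_odd) (auto simp: t_def s_def)
        finally show ?thesis using r by simp
      next
        case False
        then have "even N" by simp
        then obtain r where r: "N = 2 * r" by (rule evenE)
        have "c * t N = t r * (t (r + 2) * t (r - 1) ^ 2 - t (r - 2) * t (r + 1) ^ 2)"
          by (rule dbl(2)) (use r in auto)
        also have "\<dots> = c * s (2 * r)"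
          unfolding s_def using r N5 by (subst division_seq_even) (auto simp: t_def s_def)
        finally show ?thesis using r c by simp
      qed
      then show ?thesis
        using tS[of m] by (simp add: somos_sum_def t_def N_def)
    qed
  qed
  show "somos_sum c \<gamma> s m" by (rule sum)
  define x where "x n = s (n + 1) * s (n - 1) / s n ^ 2" for n
  have "x (m + 1)^2 * x (m + 2)^2 - \<gamma> * x (m + 1) * x (m + 2) + c^2 * (x (m + 1) + x (m + 2)) - s 3 = 0"
    unfolding x_def
    by (rule doubling_of_somos(1)[where N = "m + 5"])
      (use sum nz s_init in \<open>auto simp: somos_sum_def\<close>)
  then have J: "x (m + 1)^2 * x (m + 2)^2 - \<gamma> * x (m + 1) * x (m + 2) + c^2 * (x (m + 1) + x (m + 2)) = \<beta>"
    using s_init by simp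
  have nz': "s (m + 1) \<noteq> 0" "s (m + 2) \<noteq> 0" using nz by auto
  define p q where "p = s (m + 1)" and "q = s (m + 2)"
  have pq: "p \<noteq> 0" "q \<noteq> 0" using nz' by (simp_all add: p_def q_def)
  have xp: "x (m + 1) = q * s m / p^2" "x (m + 2) = s (m + 3) * p / q^2"
    by (simp_all add: x_def p_def q_def numeral_eq_Suc)
  have "\<beta> * p^2 * q^2 = (s m * s (m + 3))^2 - \<gamma> * s m * p * q * s (m + 3)
      + c^2 * (s m * q^3 + s (m + 3) * p^3)"
    unfolding J[symmetric] xp using pq by (simp add: field_simps power2_eq_square power3_eq_cube)
  then show "somos_biquadratic c \<beta> \<gamma> s m"
    by (simp add: somos_biquadratic_def p_def q_def)
qed

lemma (in ring_morphism) somos_image: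
  assumes "somos_sum c \<gamma> s m"
  shows "somos_sum (h c) (h \<gamma>) (\<lambda>n. h (s n)) m"
  using arg_cong[OF assms[unfolded somos_sum_def], of h] by (simp add: somos_sum_def)

lemma (in ring_morphism) biquadratic_image:
  assumes "somos_biquadratic c \<beta> \<gamma> s m"
  shows "somos_biquadratic (h c) (h \<beta>) (h \<gamma>) (\<lambda>n. h (s n)) m"
  using arg_cong[OF assms[unfolded somos_biquadratic_def], of h] by (simp add: somos_biquadratic_def)

text \<open>The three variables of \<open>\<int>[c, \<beta>, \<gamma>]\<close>, realised by iterated univariate polynomials.\<close>

abbreviation generic_c :: "int poly poly poly" where "generic_c \<equiv> [:[:[:0, 1:]:]:]"
abbreviation generic_\<beta> :: "int poly poly poly" where "generic_\<beta> \<equiv> [:[:0, 1:]:]"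
abbreviation generic_\<gamma> :: "int poly poly poly" where "generic_\<gamma> \<equiv> [:0, 1:]"

lemma generic_specialisation:
  fixes c \<beta> \<gamma> :: "'a::comm_ring_1"
  obtains h :: "int poly poly poly \<Rightarrow> 'a" where "ring_morphism h"
    "h generic_c = c" "h generic_\<beta> = \<beta>" "h generic_\<gamma> = \<gamma>"
proof -
  interpret h0: ring_morphism "of_int :: int \<Rightarrow> 'a"
    by standard auto
  define h1 where "h1 p = poly (map_poly of_int p) c" for p
  interpret h1: ring_morphism h1
    unfolding h1_def by (rule h0.eval_morphism)
  define h2 where "h2 p = poly (map_poly h1 p) \<beta>" for p
  interpret h2: ring_morphism h2
    unfolding h2_def by (rule h1.eval_morphism)
  define h3 where "h3 p = poly (map_poly h2 p) \<gamma>" for p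
  have "ring_morphism h3"
    unfolding h3_def by (rule h2.eval_morphism)
  moreover have "h3 generic_c = c" "h3 generic_\<beta> = \<beta>" "h3 generic_\<gamma> = \<gamma>"
    using h0.eval_var[of c] h1.eval_var[of \<beta>]
    by (simp_all only: h3_def h2.eval_const h2.eval_var h2_def h1.eval_const h1.eval_var h1_def h0.eval_var)
  ultimately show ?thesis using that by blast
qed

text \<open>
  The two relations are polynomial identities in \<open>c\<close>, \<open>\<beta>\<close>, \<open>\<gamma>\<close>. They hold for the generic sequence
  in the fraction field of \<open>\<int>[c, \<beta>, \<gamma>]\<close>, where nothing vanishes, and specialise to every
  commutative ring. In this way they become available for torsion points and in positive
  characteristic, where the sequence does have zeros.
\<close>

lemma division_seq_somos:
  fixes c \<beta> \<gamma> :: "'a::comm_ring_1"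
  shows "somos_sum c \<gamma> (division_seq c \<beta> \<gamma>) m"
    and "somos_biquadratic c \<beta> \<gamma> (division_seq c \<beta> \<gamma>) m"
proof -
  let ?s = "division_seq generic_c generic_\<beta> generic_\<gamma>"
  obtain k :: "int poly poly poly \<Rightarrow> int" where k: "ring_morphism k"
    "k generic_c = 2" "k generic_\<beta> = 3" "k generic_\<gamma> = 6"
    by (rule generic_specialisation)
  have nz: "?s n \<noteq> 0" if "n \<ge> 1" for n
  proof
    assume "?s n = 0"
    then have "k (?s n) = 0" using ring_morphism.zero[OF k(1)] by simp
    then show False
      using that by (simp add: ring_morphism.division_seq_image[OF k(1)] k division_seq_cusp)
  qed
  interpret frac: ring_morphism "to_fract :: int poly poly poly \<Rightarrow> _"
    by standard auto
  have frac_nz: "division_seq (to_fract generic_c) (to_fract generic_\<beta>) (to_fract generic_\<gamma>) n \<noteq> 0"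
    if "n \<ge> 1" for n
    using nz[OF that] by (simp flip: frac.division_seq_image)
  have "somos_sum generic_c generic_\<gamma> ?s m" "somos_biquadratic generic_c generic_\<beta> generic_\<gamma> ?s m"
    using somos_of_nonvanishing[OF frac_nz, of m]
    unfolding frac.division_seq_image[symmetric] somos_sum_def somos_biquadratic_def
    by (simp_all only: to_fract_eq_iff flip: to_fract_add to_fract_diff to_fract_mult frac.power)
  moreover obtain h :: "int poly poly poly \<Rightarrow> 'a" where h: "ring_morphism h"
    "h generic_c = c" "h generic_\<beta> = \<beta>" "h generic_\<gamma> = \<gamma>"
    by (rule generic_specialisation)
  moreover have "(\<lambda>n. h (?s n)) = division_seq c \<beta> \<gamma>"
    by (simp add: fun_eq_iff ring_morphism.division_seq_image[OF h(1)] h(2-4))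
  ultimately show "somos_sum c \<gamma> (division_seq c \<beta> \<gamma>) m"
      "somos_biquadratic c \<beta> \<gamma> (division_seq c \<beta> \<gamma>) m"
    using ring_morphism.somos_image[OF h(1)] ring_morphism.biquadratic_image[OF h(1)] h(2-4)
    by metis+
qed

section \<open>Multiples of a point on a Weierstrass curve\<close>

text \<open>
  If \<open>s\<^sub>m\<^sub>+\<^sub>3 = s\<^sub>m\<^sub>+\<^sub>4 = 0\<close>, then the sum relation reduces to \<open>c\<^sup>2 s\<^sub>m\<^sub>+\<^sub>2\<^sup>3 = 0\<close>; so two consecutive zeros
  would propagate down to \<open>s\<^sub>1 = 1\<close>.
\<close>

lemma division_seq_no_consecutive_zeros:
  fixes c \<beta> \<gamma> :: "'a::field"
  assumes "c \<noteq> 0" and "division_seq c \<beta> \<gamma> n = 0"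
  shows "division_seq c \<beta> \<gamma> (n + 1) \<noteq> 0"
  using assms(2)
proof (induction n)
  case 0
  then show ?case by simp
next
  case (Suc n)
  let ?s = "division_seq c \<beta> \<gamma>"
  show ?case
  proof
    assume z: "?s (Suc n + 1) = 0"
    have "n \<noteq> 0" using Suc.prems by (intro notI) simp
    moreover have "n \<noteq> 1" using Suc.prems assms(1) by (intro notI) (simp flip: numeral_2_eq_2)
    ultimately have "2 \<le> n" by simp
    then obtain m where m: "n = m + 2"
      using le_Suc_ex[of 2 n] by (auto simp: add.commute)
    have "?s (m + 3) = 0" "?s (m + 4) = 0"
      using Suc.prems z by (simp_all add: m eval_nat_numeral)
    then have "?s (m + 2) = 0"
      using division_seq_somos(1)[of c \<gamma> \<beta> m] assms(1) by (simp add: somos_sum_def)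
    then show False using Suc.IH Suc.prems by (simp add: m)
  qed
qed

text \<open>
  The ordinate of \<open>nP\<close> is determined by the abscissas of \<open>P\<close>, \<open>nP\<close> and \<open>(n + 1)P\<close>: modulo the equation
  of the curve, the square of the slope of the chord through \<open>P\<close> and \<open>nP\<close> is linear in the ordinate
  of \<open>nP\<close>. This gives a formula in \<open>x\<^sub>n\<close> and \<open>x\<^sub>n\<^sup>2 x\<^sub>n\<^sub>+\<^sub>1\<close> only. The slope then becomes
  \<open>(\<gamma> - 2 x\<^sub>n x\<^sub>n\<^sub>+\<^sub>1) / (2 c)\<close>, an expression that also covers the tangent case \<open>x\<^sub>n = 0\<close>. In the step
  from \<open>nP\<close> to \<open>(n + 1)P\<close> the biquadratic relation yields the new abscissa and the sum relation the
  new ordinate.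

  The constant \<open>\<beta>\<close> is the third division polynomial, with the constant coefficient of the curve
  eliminated through the equation of the curve at \<open>(u, v)\<close>.
\<close>

lemma weierstrass_mult_division_seq:
  fixes A u v :: "'a::field"
  assumes two: "(2::'a) \<noteq> 0" and v: "v \<noteq> 0"
  defines "c \<equiv> 2 * v" and "\<gamma> \<equiv> 6 * u^2 + 2 * A" and "\<beta> \<equiv> 12 * v^2 * u - (3 * u^2 + A)^2"
  defines "s \<equiv> division_seq c \<beta> \<gamma>"
  shows "weierstrass_mult A (n + 1) (WPt u v) =
    (if s (n + 1) = 0 then WInf
     else WPt (u - s (n + 2) * s n / s (n + 1)^2)
       ((c^2 - \<gamma> * (s (n + 2) * s n / s (n + 1)^2) + 2 * (s n ^ 2 * s (n + 3) / s (n + 1) ^ 3)) / (2 * c)))"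
proof -
  have c: "c \<noteq> 0" using two v by (simp add: c_def)
  have v_c: "v = c / 2" using two by (simp add: c_def)
  have c2: "c^2 / (2 * c) = v" using c two by (simp add: v_c power2_eq_square)
  have four: "(4::'a) \<noteq> 0"
  proof -
    have "(4::'a) = 2 * 2" by simp
    then show ?thesis using two by (metis mult_eq_0_iff)
  qed
  have inv: "\<gamma>^2 + 4 * \<beta> = 12 * (c^2 * u)"
    by (simp add: \<gamma>_def \<beta>_def c_def algebra_simps power2_eq_square)
  show ?thesis
  proof (induction n)
    case 0
    then show ?case using two v four by (simp add: s_def c_def power2_eq_square)
  next
    case (Suc n)
    define p q r t k where "p = s n" and "q = s (n + 1)" and "r = s (n + 2)" and "t = s (n + 3)"
      and "k = s (n + 4)"
    have ix: "s (Suc n) = q" "s (Suc n + 1) = r" "s (Suc n + 2) = t" "s (Suc n + 3) = k"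
      by (simp_all add: q_def r_def t_def k_def eval_nat_numeral)
    have S: "q^2 * k + t^2 * p = \<gamma> * q * r * t - c^2 * r^3"
      using division_seq_somos(1)[of c \<gamma> \<beta> n]
      by (simp add: somos_sum_def p_def q_def r_def t_def k_def s_def)
    have J: "(p * t)^2 - \<gamma> * p * q * r * t + c^2 * (p * r^3 + t * q^3) = \<beta> * q^2 * r^2"
      using division_seq_somos(2)[of c \<beta> \<gamma> n]
      by (simp add: somos_biquadratic_def p_def q_def r_def t_def k_def s_def)
    have nz: "q = 0 \<Longrightarrow> r \<noteq> 0" "r = 0 \<Longrightarrow> t \<noteq> 0"
      using division_seq_no_consecutive_zeros[OF c, of \<beta> \<gamma> "n + 1"]
        division_seq_no_consecutive_zeros[OF c, of \<beta> \<gamma> "n + 2"]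
      by (auto simp: q_def r_def t_def s_def eval_nat_numeral)
    define Q where "Q = weierstrass_mult A (n + 1) (WPt u v)"
    have Q: "Q = (if q = 0 then WInf
        else WPt (u - r * p / q^2) ((c^2 - \<gamma> * (r * p / q^2) + 2 * (p^2 * t / q^3)) / (2 * c)))"
      using Suc.IH unfolding Q_def p_def q_def r_def t_def .
    have "weierstrass_add A (WPt u v) Q = (if r = 0 then WInf
        else WPt (u - t * q / r^2) ((c^2 - \<gamma> * (t * q / r^2) + 2 * (q^2 * k / r^3)) / (2 * c)))"
    proof (cases "q = 0")
      case True
      then have "t * q / r^2 = 0" "q^2 * k / r^3 = 0" by simp_all
      moreover have "Q = WInf" using True by (simp add: Q)
      ultimately show ?thesis
        using nz(1)[OF True] by (simp only: if_False weierstrass_add.simps c2 mult_zero_right diff_zero add_0_right)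
    next
      case q: False
      show ?thesis
      proof (cases "r = 0")
        case True
        \<comment> \<open>Here \<open>(n + 2)P\<close> should be the point at infinity, i.e. \<open>(n + 1)P = - P\<close>. The abscissas agree,
          and the biquadratic relation decides the sign of the ordinate.\<close>
        then have "t \<noteq> 0" by (rule nz(2))
        moreover have "t * (p^2 * t + c^2 * q^3) = 0"
          using J True by (simp add: algebra_simps power2_eq_square)
        ultimately have "p^2 * t = - (c^2 * q^3)" by (simp add: eq_neg_iff_add_eq_0)
        then have "p^2 * t / q^3 = - (c^2)" using q by simp
        then have "Q = WPt u ((c^2 - \<gamma> * 0 + 2 * (- (c^2))) / (2 * c))" using q True by (simp add: Q)
        moreover have "(c^2 - \<gamma> * 0 + 2 * (- (c^2))) / (2 * c) = - (c^2 / (2 * c))" by simp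
        ultimately have "Q = WPt u (- v)" by (simp only: c2)
        then show ?thesis using True by simp
      next
        case r: False
        define x x' where "x = r * p / q^2" and "x' = t * q / r^2"
        have x2x': "p^2 * t / q^3 = x^2 * x'"
          using q r by (simp add: x_def x'_def field_simps power2_eq_square power3_eq_cube)
        have "q^2 * k / r^3 = (\<gamma> * q * r * t - c^2 * r^3 - t^2 * p) / r^3"
          unfolding S[symmetric] by simp
        also have "\<dots> = \<gamma> * x' - c^2 - x'^2 * x"
          using q r by (simp add: x_def x'_def field_simps power2_eq_square power3_eq_cube)
        finally have kr: "q^2 * k / r^3 = \<gamma> * x' - c^2 - x'^2 * x" .
        have "x^2 * x'^2 - \<gamma> * x * x' + c^2 * (x + x')
            = ((p * t)^2 - \<gamma> * p * q * r * t + c^2 * (p * r^3 + t * q^3)) / (q^2 * r^2)"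
          using q r by (simp add: x_def x'_def field_simps power2_eq_square power3_eq_cube)
        also have "\<dots> = \<beta>" unfolding J using q r by simp
        finally have J': "x^2 * x'^2 - \<gamma> * x * x' + c^2 * (x + x') = \<beta>" .
        define m where "m = (\<gamma> - 2 * x * x') / (2 * c)"
        have "4 * c^2 * m^2 = (\<gamma> - 2 * x * x')^2"
          using c two four unfolding m_def by (simp add: power_divide power_mult_distrib)
        also have "\<dots> = \<gamma>^2 + 4 * (x^2 * x'^2 - \<gamma> * x * x')"
          by (simp add: algebra_simps power2_eq_square)
        also have "x^2 * x'^2 - \<gamma> * x * x' = \<beta> - c^2 * (x + x')"
          unfolding J'[symmetric] by simp
        also have "\<gamma>^2 + 4 * (\<beta> - c^2 * (x + x')) = 4 * c^2 * (3 * u - x - x')"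
          using inv by (simp add: algebra_simps)
        finally have m2: "m^2 = 3 * u - x - x'" using c four by simp
        have m_v: "m * x' - v = (c^2 - \<gamma> * x' + 2 * (\<gamma> * x' - c^2 - x'^2 * x)) / (2 * c)"
          using c two four unfolding m_def v_c by (simp add: field_simps power2_eq_square)
        have Qx: "Q = WPt (u - x) ((c^2 - \<gamma> * x + 2 * (x^2 * x')) / (2 * c))"
          using q by (simp add: Q x2x' flip: x_def)
        have "weierstrass_add A (WPt u v) Q = WPt (u - x') (m * x' - v)"
        proof (cases "x = 0")
          case True
          have "v \<noteq> - v" using two v by (metis add_eq_0_iff mult_2 mult_eq_0_iff)
          moreover have "(3 * u^2 + A) / (2 * v) = m"
            using two four c True unfolding m_def \<gamma>_def c_def by (simp add: field_simps)
          moreover have "Q = WPt u v"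
            unfolding Qx True by (simp add: c2[symmetric])
          ultimately show ?thesis
            using m2 True by (simp add: Let_def)
        next
          case False
          have "(c^2 - \<gamma> * x + 2 * (x^2 * x')) / (2 * c) - v = - x * m"
            using c two four unfolding m_def v_c by (simp add: field_simps power2_eq_square)
          then have "((c^2 - \<gamma> * x + 2 * (x^2 * x')) / (2 * c) - v) / (u - x - u) = m"
            using False by simp
          then show ?thesis
            using m2 False by (simp add: Qx Let_def)
        qed
        then show ?thesis using r by (simp add: m_v kr flip: x'_def)
      qed
    qed
    moreover have "weierstrass_mult A (Suc n + 1) (WPt u v) = weierstrass_add A (WPt u v) Q"
      by (simp add: Q_def)
    ultimately show ?case unfolding ix by (rule trans[rotated])
  qed
qed

section \<open>Rescaling\<close>

lemma mod_4_pred: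
  fixes r :: nat
  shows "r mod 4 = 3 \<Longrightarrow> (r - 1) mod 4 = 2"
    and "2 \<le> r \<Longrightarrow> r mod 4 = 0 \<Longrightarrow> (r - 2) mod 4 = 2"
proof -
  have "(k + 1) mod 4 = 3 \<Longrightarrow> k mod 4 = 2" for k :: nat by presburger
  from this[of "r - 1"] show "r mod 4 = 3 \<Longrightarrow> (r - 1) mod 4 = 2" by (cases r) auto
  have "(k + 2) mod 4 = 0 \<Longrightarrow> k mod 4 = 2" for k :: nat by presburger
  from this[of "r - 2"] show "2 \<le> r \<Longrightarrow> r mod 4 = 0 \<Longrightarrow> (r - 2) mod 4 = 2"
    by (metis le_add_diff_inverse2)
qed
lemma mod_4_shift:
  fixes r :: nat
  shows "r mod 4 = 0 \<Longrightarrow> (r + 2) mod 4 = 2" "r mod 4 = 2 \<Longrightarrow> (r + 2) mod 4 = 0"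
    "r mod 4 = 1 \<Longrightarrow> (r + 1) mod 4 = 2" "r mod 4 = 3 \<Longrightarrow> (r + 1) mod 4 = 0"
    "r mod 4 = 1 \<Longrightarrow> (r - 1) mod 4 = 0" "r mod 4 = 3 \<Longrightarrow> (r - 1) mod 4 = 2"
    "2 \<le> r \<Longrightarrow> r mod 4 = 0 \<Longrightarrow> (r - 2) mod 4 = 2" "r mod 4 = 2 \<Longrightarrow> (r - 2) mod 4 = 0"
    "r mod 4 = 0 \<Longrightarrow> (2 * r) mod 4 = 0" "r mod 4 = 2 \<Longrightarrow> (2 * r) mod 4 = 0"
    "r mod 4 = 1 \<Longrightarrow> (2 * r) mod 4 = 2" "r mod 4 = 3 \<Longrightarrow> (2 * r) mod 4 = 2"
    "even r \<Longrightarrow> r mod 4 \<noteq> 0 \<Longrightarrow> r mod 4 = 2" "odd r \<Longrightarrow> r mod 4 \<noteq> 3 \<Longrightarrow> r mod 4 = 1"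
  by (rule mod_4_pred; assumption | presburger)+

text \<open>
  A division sequence may be multiplied termwise by \<open>\<lambda>\<close> to the power \<open>n\<^sup>2 - 1\<close>, as happens when the
  coordinates of the curve are rescaled. The explicit factor here is \<open>L\<close> to the power \<open>e n\<close> times
  \<open>\<delta>\<close> to the power \<open>- j n\<close>, with \<open>e n\<close> about \<open>n\<^sup>2 / 2\<close> and \<open>j n\<close> about \<open>n\<^sup>2 / 8\<close>. The powers of \<open>\<delta>\<close> absorb
  the sporadic factors \<open>\<delta>\<close> of the twisted recursion: these come from the rounding of
  \<open>(n\<^sup>2 - 1) / 8\<close>, which depends on \<open>n\<close> modulo 4.
\<close>

lemma eds_scaling:
  fixes \<delta> L :: "'a::field"
  assumes nz: "\<delta> \<noteq> 0" "L \<noteq> 0"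
    and \<kappa>: "\<kappa>' * \<delta>^2 = L^6 * \<kappa>" and b3: "b3' * \<delta> = L^4 * b3" and b4: "b4' * \<delta> = L^6 * b4"
  shows "\<exists>\<rho>. \<rho> \<noteq> 0 \<and> eds 1 \<kappa>' b3' b4' n = \<rho> * eds \<delta> \<kappa> b3 b4 n"
proof -
  define M where "M i k = L powi i * \<delta> powi k" for i k
  have M_mult: "M i k * M i' k' = M (i + i') (k + k')" for i k i' k'
    using nz by (simp add: M_def power_int_add)
  have M_power: "M i k ^ m = M (int m * i) (int m * k)" for i k m
    by (induction m) (simp_all add: M_mult algebra_simps, simp add: M_def)
  have M_nz: "M i k \<noteq> 0" for i k
    using nz by (simp add: M_def power_int_eq_0_iff)
  \<comment> \<open>Integer exponents make the formulas valid at \<open>n = 0\<close> too, where both are negative.\<close>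
  define e where "e n = (int n * int n - (if even n then 4 else 1)) div 2" for n
  define j where "j n = (int n * int n - 1) div 8" for n
  have e_even: "2 * e n = int n * int n - 4" if "even n" for n
    using that by (elim evenE) (simp add: e_def)
  have e_odd: "2 * e n = int n * int n - 1" if "odd n" for n
    using that by (elim oddE) (simp add: e_def algebra_simps)
  have j0: "8 * j n = int n * int n - 8" if "n mod 4 = 0" for n
  proof -
    obtain k where "n = 4 * k" using \<open>n mod 4 = 0\<close> by (metis mod_0_imp_dvd dvdE)
    moreover have "(16 * K - 1) div 8 = 2 * K - 1" for K :: int by presburger
    ultimately show ?thesis by (simp add: j_def)
  qed
  have j1: "8 * j n = int n * int n - 1" if n: "odd n" for n
  proof -
    obtain k where k: "n = 2 * k + 1" using n by (rule oddE)
    have "even (int k * (int k + 1))" by simp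
    then obtain l where "int k * (int k + 1) = 2 * l" by (elim evenE)
    then have "int n * int n - 1 = 8 * l" by (simp add: k algebra_simps)
    then show ?thesis by (simp add: j_def)
  qed
  have j2: "8 * j n = int n * int n - 4" if "n mod 4 = 2" for n
  proof -
    have "n = 4 * (n div 4) + 2" using that by presburger
    then obtain k where k: "n = 4 * k + 2" by blast
    have "int n * int n - 1 = 8 * (2 * int k * int k + 2 * int k) + 3"
      by (simp add: k algebra_simps)
    moreover have "(8 * K + 3) div 8 = K" for K :: int by presburger
    ultimately have "j n = 2 * int k * int k + 2 * int k" by (simp only: j_def)
    then show ?thesis by (simp add: k algebra_simps)
  qed
  let ?f = "eds 1 \<kappa>' b3' b4'" and ?g = "eds \<delta> \<kappa> b3 b4"
  have \<kappa>M: "\<kappa>' = M 6 (-2) * \<kappa>"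
    using \<kappa> nz by (simp add: M_def power_int_minus field_simps)
  have twM: "twist \<delta> b = M 0 (of_bool b)" for b
    by (simp add: M_def twist_def)
  have "?f n = M (e n) (- j n) * ?g n"
  proof (induction n rule: eds_induct)
    case (init n)
    have "e 3 = 4" "e 4 = 6" "j 3 = 1" "j 4 = 1" "e 1 = 0" "e 2 = 0" "j 1 = 0" "j 2 = 0"
      by (simp_all add: e_def j_def)
    moreover have "M 0 0 = 1" by (simp add: M_def)
    moreover have "b3' = M 4 (-1) * b3" "b4' = M 6 (-1) * b4"
      using b3 b4 nz by (simp_all add: M_def power_int_minus field_simps)
    ultimately show ?case using init by auto
  next
    case (odd r)
    have m1: "int (r - 1) = int r - 1" "int (r - Suc 0) = int r - 1" using odd.hyps by simp_all
    show ?case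
    proof (cases "even r")
      case True
      have par: "odd (2 * r + 1)" "odd (r - 1)" "odd (r + 1)" "even (r + 2)"
        using True odd.hyps by auto
      have E: "e (2 * r + 1) = 6 + e (r + 2) + 3 * e r" "e (2 * r + 1) = e (r - 1) + 3 * e (r + 1)"
        using e_even[OF True] e_odd[OF par(1)] e_odd[OF par(2)] e_odd[OF par(3)] e_even[OF par(4)]
        by (simp_all add: m1 algebra_simps)
      have J: "j (2 * r + 1) = j (r - 1) + 3 * j (r + 1)"
        using j1[OF par(1)] j1[OF par(2)] j1[OF par(3)] by (simp add: m1 algebra_simps)
      have J': "j (2 * r + 1) = 2 + j (r + 2) + 3 * j r + of_bool (r mod 4 = 0)"
      proof (cases "r mod 4 = 0")
        case True
        then have "(r + 2) mod 4 = 2" by (rule mod_4_shift)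
        then show ?thesis
          using j1[OF par(1)] j0[OF True] j2[of "r + 2"] True by (simp add: algebra_simps)
      next
        case False
        then have r2: "r mod 4 = 2" using mod_4_shift(13)[OF \<open>even r\<close>] by blast
        then have "(r + 2) mod 4 = 0" by (rule mod_4_shift)
        then show ?thesis
          using j1[OF par(1)] j2[OF r2] j0[of "r + 2"] False by (simp add: algebra_simps)
      qed
      have 1: "M 6 (-2) * (M (e (r + 2)) (- j (r + 2)) * M (e r) (- j r) ^ 3)
          = M (e (2 * r + 1)) (- j (2 * r + 1)) * M 0 (of_bool (r mod 4 = 0))"
        unfolding M_power M_mult E(1) J' by (simp add: algebra_simps)
      have 2: "M (e (r - 1)) (- j (r - 1)) * M (e (r + 1)) (- j (r + 1)) ^ 3
          = M (e (2 * r + 1)) (- j (2 * r + 1))"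
        unfolding M_power M_mult E(2) J by (simp add: algebra_simps)
      have "?f (2 * r + 1)
          = M 6 (-2) * (M (e (r + 2)) (- j (r + 2)) * M (e r) (- j r) ^ 3) * (\<kappa> * ?g (r + 2) * ?g r ^ 3)
          - (M (e (r - 1)) (- j (r - 1)) * M (e (r + 1)) (- j (r + 1)) ^ 3) * (?g (r - 1) * ?g (r + 1) ^ 3)"
        unfolding eds_odd_even[OF odd.hyps True] odd.IH
        unfolding \<kappa>M by (simp add: power_mult_distrib mult_ac)
      also have "\<dots> = M (e (2 * r + 1)) (- j (2 * r + 1)) * ?g (2 * r + 1)"
        unfolding eds_odd_even[OF odd.hyps True] 1 2 twM by (simp add: algebra_simps)
      finally show ?thesis .
    next
      case False
      have par: "odd (2 * r + 1)" "even (r - 1)" "even (r + 1)" "odd (r + 2)"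
        using False odd.hyps by auto
      have E: "e (2 * r + 1) = e (r + 2) + 3 * e r" "e (2 * r + 1) = 6 + e (r - 1) + 3 * e (r + 1)"
        using e_odd[OF False] e_odd[OF par(1)] e_even[OF par(2)] e_even[OF par(3)] e_odd[OF par(4)]
        by (simp_all add: m1 algebra_simps)
      have J: "j (2 * r + 1) = j (r + 2) + 3 * j r"
        using j1[OF par(1)] j1[OF par(4)] j1[OF False] by (simp add: algebra_simps)
      have J': "j (2 * r + 1) = 2 + j (r - 1) + 3 * j (r + 1) + of_bool (r mod 4 = 3)"
      proof (cases "r mod 4 = 3")
        case True
        then have "(r - 1) mod 4 = 2" "(r + 1) mod 4 = 0" by (simp_all only: mod_4_shift)
        then show ?thesis
          using j1[OF par(1)] j2[of "r - 1"] j0[of "r + 1"] True by (simp add: m1 algebra_simps)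
      next
        case False
        then have "r mod 4 = 1" using mod_4_shift(14)[OF \<open>odd r\<close>] by blast
        then have "(r - 1) mod 4 = 0" "(r + 1) mod 4 = 2" by (simp_all only: mod_4_shift)
        then show ?thesis
          using j1[OF par(1)] j0[of "r - 1"] j2[of "r + 1"] False by (simp add: m1 algebra_simps)
      qed
      have 1: "M (e (r + 2)) (- j (r + 2)) * M (e r) (- j r) ^ 3
          = M (e (2 * r + 1)) (- j (2 * r + 1))"
        unfolding M_power M_mult E(1) J by (simp add: algebra_simps)
      have 2: "M 6 (-2) * (M (e (r - 1)) (- j (r - 1)) * M (e (r + 1)) (- j (r + 1)) ^ 3)
          = M (e (2 * r + 1)) (- j (2 * r + 1)) * M 0 (of_bool (r mod 4 = 3))"
        unfolding M_power M_mult E(2) J' by (simp add: algebra_simps)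
      have "?f (2 * r + 1)
          = (M (e (r + 2)) (- j (r + 2)) * M (e r) (- j r) ^ 3) * (?g (r + 2) * ?g r ^ 3)
          - M 6 (-2) * (M (e (r - 1)) (- j (r - 1)) * M (e (r + 1)) (- j (r + 1)) ^ 3)
            * (\<kappa> * ?g (r - 1) * ?g (r + 1) ^ 3)"
        unfolding eds_odd_odd[OF odd.hyps False] odd.IH
        unfolding \<kappa>M by (simp add: power_mult_distrib mult_ac)
      also have "\<dots> = M (e (2 * r + 1)) (- j (2 * r + 1)) * ?g (2 * r + 1)"
        unfolding eds_odd_odd[OF odd.hyps False] 1 2 twM by (simp add: algebra_simps)
      finally show ?thesis .
    qed
  next
    case (even r)
    have m1: "int (r - 1) = int r - 1" "int (r - Suc 0) = int r - 1" "int (r - 2) = int r - 2" using even.hyps by simp_all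
    have E: "e (2 * r) = e r + e (r + 2) + 2 * e (r - 1) \<and> e (2 * r) = e r + e (r - 2) + 2 * e (r + 1)"
    proof (cases "even r")
      case True
      then have "even (2 * r)" "even (r + 2)" "even (r - 2)" "odd (r - 1)" "odd (r + 1)"
        using even.hyps by auto
      then show ?thesis
        using True e_even[of "2 * r"] e_even[of r] e_even[of "r + 2"] e_even[of "r - 2"]
          e_odd[of "r - 1"] e_odd[of "r + 1"] by (simp add: m1 algebra_simps)
    next
      case False
      then have "even (2 * r)" "odd (r + 2)" "odd (r - 2)" "even (r - 1)" "even (r + 1)"
        using even.hyps by auto
      then show ?thesis
        using False e_even[of "2 * r"] e_odd[of r] e_odd[of "r + 2"] e_odd[of "r - 2"]
          e_even[of "r - 1"] e_even[of "r + 1"] by (simp add: m1 algebra_simps)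
    qed
    have J: "j (2 * r) = j r + j (r + 2) + 2 * j (r - 1) + of_bool (r mod 4 = 1)
        \<and> j (2 * r) = j r + j (r - 2) + 2 * j (r + 1) + of_bool (r mod 4 = 3)"
    proof -
      consider "r mod 4 = 0" | "r mod 4 = 1" | "r mod 4 = 2" | "r mod 4 = 3" by linarith
      then show ?thesis
      proof cases
        case 1
        have "(2 * r) mod 4 = 0" "(r + 2) mod 4 = 2" "(r - 2) mod 4 = 2"
          using mod_4_shift[of r] 1 even.hyps by simp_all
        moreover have "odd (r - 1)" "odd (r + 1)"
          using 1 even.hyps by presburger+
        ultimately show ?thesis
          using 1 j0[of "2 * r"] j0[of r] j2[of "r + 2"] j2[of "r - 2"] j1[of "r - 1"] j1[of "r + 1"]
          by (simp add: m1 algebra_simps)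
      next
        case 2
        have "(2 * r) mod 4 = 2" "(r - 1) mod 4 = 0" "(r + 1) mod 4 = 2"
          using mod_4_shift[of r] 2 even.hyps by simp_all
        moreover have "odd r" "odd (r + 2)" "odd (r - 2)"
          using 2 even.hyps by presburger+
        ultimately show ?thesis
          using 2 j2[of "2 * r"] j1[of r] j1[of "r + 2"] j1[of "r - 2"] j0[of "r - 1"] j2[of "r + 1"]
          by (simp add: m1 algebra_simps)
      next
        case 3
        have "(2 * r) mod 4 = 0" "(r + 2) mod 4 = 0" "(r - 2) mod 4 = 0"
          using mod_4_shift[of r] 3 even.hyps by simp_all
        moreover have "odd (r - 1)" "odd (r + 1)"
          using 3 even.hyps by presburger+
        ultimately show ?thesis
          using 3 j0[of "2 * r"] j2[of r] j0[of "r + 2"] j0[of "r - 2"] j1[of "r - 1"] j1[of "r + 1"]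
          by (simp add: m1 algebra_simps)
      next
        case 4
        have "(2 * r) mod 4 = 2" "(r - 1) mod 4 = 2" "(r + 1) mod 4 = 0"
          using mod_4_shift[of r] 4 even.hyps by simp_all
        moreover have "odd r" "odd (r + 2)" "odd (r - 2)"
          using 4 even.hyps by presburger+
        ultimately show ?thesis
          using 4 j2[of "2 * r"] j1[of r] j1[of "r + 2"] j1[of "r - 2"] j2[of "r - 1"] j0[of "r + 1"]
          by (simp add: m1 algebra_simps)
      qed
    qed
    have 1: "M (e r) (- j r) * (M (e (r + 2)) (- j (r + 2)) * M (e (r - 1)) (- j (r - 1)) ^ 2)
        = M (e (2 * r)) (- j (2 * r)) * M 0 (of_bool (r mod 4 = 1))"
      unfolding M_power M_mult conjunct1[OF E] conjunct1[OF J] by (simp add: algebra_simps)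
    have 2: "M (e r) (- j r) * (M (e (r - 2)) (- j (r - 2)) * M (e (r + 1)) (- j (r + 1)) ^ 2)
        = M (e (2 * r)) (- j (2 * r)) * M 0 (of_bool (r mod 4 = 3))"
      unfolding M_power M_mult conjunct2[OF E] conjunct2[OF J] by (simp add: algebra_simps)
    have "?f (2 * r)
        = (M (e r) (- j r) * (M (e (r + 2)) (- j (r + 2)) * M (e (r - 1)) (- j (r - 1)) ^ 2))
            * (?g r * ?g (r + 2) * ?g (r - 1) ^ 2)
          - (M (e r) (- j r) * (M (e (r - 2)) (- j (r - 2)) * M (e (r + 1)) (- j (r + 1)) ^ 2))
            * (?g r * ?g (r - 2) * ?g (r + 1) ^ 2)"
      unfolding eds_even[OF even.hyps] even.IH by (simp add: power_mult_distrib algebra_simps)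
    also have "\<dots> = M (e (2 * r)) (- j (2 * r)) * ?g (2 * r)"
      unfolding eds_even[OF even.hyps] 1 2 twM by (simp add: algebra_simps)
    finally show ?case .
  qed
  then show ?thesis using M_nz by blast
qed

section \<open>The Edwards polynomials as a twisted sequence\<close>

lemma edwards_psi_odd_even:
  assumes "r \<ge> 2" "even r"
  shows "\<psi> a d (2 * r + 1) =
    twist (ratconst a - ratconst d) (r mod 4 = 0) * (4 * (ratconst a - ratconst d * ratvar^2)^2)
        * \<psi> a d (r + 2) * \<psi> a d r ^ 3 / (ratvar + 1)^2
      - \<psi> a d (r - 1) * \<psi> a d (r + 1) ^ 3"
proof -
  have "r mod 4 = 0 \<or> r mod 4 = 2" using assms(2) by presburger
  then show ?thesis
    using assms by (subst edwards_psi.simps) (auto simp: Let_def mult_ac)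
qed

lemma edwards_psi_odd_odd:
  assumes "r \<ge> 2" "odd r"
  shows "\<psi> a d (2 * r + 1) =
    \<psi> a d (r + 2) * \<psi> a d r ^ 3
      - twist (ratconst a - ratconst d) (r mod 4 = 3) * (4 * (ratconst a - ratconst d * ratvar^2)^2)
          * \<psi> a d (r - 1) * \<psi> a d (r + 1) ^ 3 / (ratvar + 1)^2"
proof -
  have "r mod 4 = 1 \<or> r mod 4 = 3" using assms(2) by presburger
  then show ?thesis
    using assms by (subst edwards_psi.simps) (auto simp: Let_def mult_ac)
qed

lemma edwards_psi_even:
  assumes "r \<ge> 3"
  shows "\<psi> a d (2 * r) = \<psi> a d r / (ratvar + 1) *
    (twist (ratconst a - ratconst d) (r mod 4 = 1) * \<psi> a d (r + 2) * \<psi> a d (r - 1) ^ 2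
      - twist (ratconst a - ratconst d) (r mod 4 = 3) * \<psi> a d (r - 2) * \<psi> a d (r + 1) ^ 2)"
proof -
  consider "r mod 4 = 0" | "r mod 4 = 1" | "r mod 4 = 2" | "r mod 4 = 3" by linarith
  then show ?thesis
    by cases (use assms in \<open>subst edwards_psi.simps, simp add: Let_def\<close>)+
qed

text \<open>
  Removing the factor \<open>y + 1\<close> from the terms of even index cancels all denominators \<open>y + 1\<close> of the
  recursion, and leaves the factor \<open>(y + 1)\<^sup>2\<close> in \<open>\<kappa>\<close>.
\<close>

lemma edwards_psi_eq_eds:
  "\<psi> a d n = (if even n then ratvar + 1 else 1) *
    eds (ratconst a - ratconst d) (4 * (ratconst a - ratconst d * ratvar^2)^2 * (ratvar + 1)^2)
      (- ratconst d * ratvar^4 - 2 * ratconst d * ratvar^3 + 2 * ratconst a * ratvar + ratconst a)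
      (- 2 * ratvar * (ratconst d * ratvar^4 - ratconst a)) n"
  (is "_ = _ * ?e n")
proof -
  define Y :: "'a poly fract" where "Y = ratvar + 1"
  have "Y = to_fract [:1, 1:]"
    by (simp add: Y_def ratvar_def one_pCons flip: to_fract_add to_fract_1)
  then have Y: "Y \<noteq> 0" by simp
  define E where "E = 4 * (ratconst a - ratconst d * ratvar^2 :: 'a poly fract)^2"
  define D where "D = (ratconst a - ratconst d :: 'a poly fract)"
  define e where "e = ?e"
  have red: "T * E * (Y * F) * (Y * G) ^ 3 / Y^2 = T * (E * Y^2) * F * G ^ 3" for T F G
    using Y by (simp add: power_mult_distrib power2_eq_square power3_eq_cube)
  have red1: "Y * G / Y * (T * (Y * F) * H ^ 2 - T' * (Y * F') * H' ^ 2)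
      = Y * (G * (T * F * H ^ 2 - T' * F' * H' ^ 2))" for T F G H T' F' H'
    using Y by (simp add: algebra_simps)
  have red2: "G / Y * (T * F * (Y * H) ^ 2 - T' * F' * (Y * H') ^ 2)
      = Y * (G * (T * F * H ^ 2 - T' * F' * H' ^ 2))" for T F G H T' F' H'
    using Y by (simp add: algebra_simps power2_eq_square)
  have "\<psi> a d n = (if even n then Y else 1) * e n"
  proof (induction n rule: eds_induct)
    case (init n)
    have "e 4 = - 2 * ratvar * (ratconst d * ratvar^4 - ratconst a)"
      unfolding e_def by simp
    then have "\<psi> a d 4 = Y * e 4"
      by (simp only: edwards_psi_initial Y_def mult_ac)
    moreover have "\<psi> a d 3 = e 3" "\<psi> a d 2 = Y * e 2" "\<psi> a d 1 = e 1" "\<psi> a d 0 = Y * e 0"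
      by (simp_all add: edwards_psi_initial edwards_psi_initial(2)[simplified] Y_def e_def)
    ultimately show ?case using init by auto
  next
    case (odd r)
    note IH = odd.IH
    show ?case
    proof (cases "even r")
      case True
      then have par: "even (r + 2)" "odd (r - 1)" "odd (r + 1)" "odd (2 * r + 1)"
        using odd.hyps by auto
      have "\<psi> a d (2 * r + 1) = twist D (r mod 4 = 0) * E * (Y * e (r + 2)) * (Y * e r) ^ 3 / Y^2
          - e (r - 1) * e (r + 1) ^ 3"
        using edwards_psi_odd_even[OF odd.hyps True, of a d] IH par True
        by (simp only: E_def D_def Y_def if_True if_False mult_1 refl)
      also have "\<dots> = e (2 * r + 1)"
        unfolding red unfolding e_def E_def D_def Y_def eds_odd_even[OF odd.hyps True] ..
      finally show ?thesis using par by simp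
    next
      case False
      then have par: "odd (r + 2)" "even (r - 1)" "even (r + 1)" "odd (2 * r + 1)"
        using odd.hyps by auto
      have "\<psi> a d (2 * r + 1) = e (r + 2) * e r ^ 3
          - twist D (r mod 4 = 3) * E * (Y * e (r - 1)) * (Y * e (r + 1)) ^ 3 / Y^2"
        using edwards_psi_odd_odd[OF odd.hyps False, of a d] IH par False
        by (simp only: E_def D_def Y_def if_True if_False mult_1 refl)
      also have "\<dots> = e (2 * r + 1)"
        unfolding red unfolding e_def E_def D_def Y_def eds_odd_odd[OF odd.hyps False] ..
      finally show ?thesis using par by simp
    qed
  next
    case (even r)
    note IH = even.IH
    have e: "e r * (twist D (r mod 4 = 1) * e (r + 2) * e (r - 1) ^ 2
        - twist D (r mod 4 = 3) * e (r - 2) * e (r + 1) ^ 2) = e (2 * r)"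
      unfolding e_def D_def eds_even[OF even.hyps] ..
    show ?case
    proof (cases "even r")
      case True
      then have par: "even (r + 2)" "even (r - 2)" "odd (r - 1)" "odd (r + 1)"
        using even.hyps by auto
      have "\<psi> a d (2 * r) = Y * e r / Y * (twist D (r mod 4 = 1) * (Y * e (r + 2)) * e (r - 1) ^ 2
          - twist D (r mod 4 = 3) * (Y * e (r - 2)) * e (r + 1) ^ 2)"
        using edwards_psi_even[OF even.hyps, of a d] IH par True
        by (simp only: D_def Y_def if_True if_False mult_1 refl)
      then show ?thesis unfolding red1 e by simp
    next
      case False
      then have par: "odd (r + 2)" "odd (r - 2)" "even (r - 1)" "even (r + 1)"
        using even.hyps by auto
      have "\<psi> a d (2 * r) = e r / Y * (twist D (r mod 4 = 1) * e (r + 2) * (Y * e (r - 1)) ^ 2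
          - twist D (r mod 4 = 3) * e (r - 2) * (Y * e (r + 1)) ^ 2)"
        using edwards_psi_even[OF even.hyps, of a d] IH par False
        by (simp only: D_def Y_def if_True if_False mult_1 refl)
      then show ?thesis unfolding red2 e by simp
    qed
  qed
  then show ?thesis by (simp only: Y_def e_def)
qed

text \<open>The values of \<open>\<psi>\<^sub>n\<close> at \<open>y\<close>, with the factor \<open>y + 1\<close> removed for even \<open>n\<close>.\<close>

definition edwards_eds :: "'a::field \<Rightarrow> 'a \<Rightarrow> 'a \<Rightarrow> nat \<Rightarrow> 'a" where
  "edwards_eds a d y = eds (a - d) (4 * (a - d * y^2)^2 * (y + 1)^2)
    (- d * y^4 - 2 * d * y^3 + 2 * a * y + a) (- 2 * y * (d * y^4 - a))"

lemma poly_edwards_psi: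
  fixes a d :: "'k::field"
  shows "poly (map_poly to_ac (edwards_psi_poly a d n)) y =
    (if even n then y + 1 else 1) * edwards_eds (to_ac a) (to_ac d) y n"
proof -
  interpret ac: ring_morphism "to_ac :: 'k \<Rightarrow> 'k alg_closure"
    by standard auto
  interpret ev: ring_morphism "\<lambda>p. poly (map_poly to_ac p) y"
    by (rule ac.eval_morphism)
  interpret frac: ring_morphism "to_fract :: 'k poly \<Rightarrow> _"
    by standard auto
  let ?p = "(if even n then [:0, 1:] + 1 else 1) *
    eds ([:a:] - [:d:]) (4 * ([:a:] - [:d:] * [:0, 1:]^2)^2 * ([:0, 1:] + 1)^2)
      (- [:d:] * [:0, 1:]^4 - 2 * [:d:] * [:0, 1:]^3 + 2 * [:a:] * [:0, 1:] + [:a:])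
      (- 2 * [:0, 1:] * ([:d:] * [:0, 1:]^4 - [:a:])) n"
  have "to_fract ?p = \<psi> a d n"
    unfolding edwards_psi_eq_eds ratvar_def ratconst_def
    by (simp only: frac.mult frac.eds_image frac.diff frac.add frac.power frac.uminus frac.numeral
        frac.one if_distrib[of to_fract])
  then have p: "edwards_psi_poly a d n = ?p"
    by (simp only: to_fract_eq_iff flip: to_fract_edwards_psi_poly)
  show ?thesis
    unfolding p edwards_eds_def
    by (simp only: ev.mult ev.eds_image ev.diff ev.add ev.power ev.uminus ev.numeral ev.one
        ac.eval_const ac.eval_var if_distrib[of "\<lambda>p. poly (map_poly to_ac p) y"])
qed

text \<open>
  For \<open>\<kappa> = 0\<close> the recursion for odd indices keeps a single product of terms of odd index. This
  settles \<open>y = -1\<close>, where \<open>\<kappa>\<close> vanishes.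
\<close>

lemma eds_odd_nonzero:
  fixes \<delta> :: "'a::field"
  assumes "b3 \<noteq> 0" "odd n"
  shows "eds \<delta> 0 b3 b4 n \<noteq> 0"
  using assms(2)
proof (induction n rule: eds_induct)
  case (init n)
  then show ?case using assms(1) by auto
next
  case (odd r)
  then show ?case
    by (cases "even r") (simp_all add: eds_odd_even[simplified] eds_odd_odd[simplified])
qed simp_all

section \<open>Torsion points of the Edwards curve\<close>

lemma weierstrass_mult_two_torsion:
  "weierstrass_mult A n (WPt u 0) = (if even n then WInf else WPt u 0)"
  by (induction n) auto

lemma edwards_torsion_iff_minus_one:
  fixes a d :: "'a::field"
  assumes "(2::'a) \<noteq> 0" and "a \<noteq> d" and "(x, -1) \<in> edwards_curve a d"
  shows "edwards_torsion a d n (x, -1) \<longleftrightarrow> (if even n then -1 + 1 else 1) * edwards_eds a d (-1) n = 0"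
proof -
  have "x^2 * (a - d) = 0"
    using assms(3) by (simp add: edwards_curve_def algebra_simps)
  then have x: "x = 0" using assms(2) by simp
  have "edwards_eds a d (-1) n \<noteq> 0" if "odd n"
    using eds_odd_nonzero[OF _ that, of "d - a"] assms(2) by (simp add: edwards_eds_def)
  then show ?thesis
    using assms(1) by (auto simp: edwards_torsion_def edwards_to_weierstrass_def x weierstrass_mult_two_torsion)
qed

text \<open>
  For \<open>y \<noteq> -1\<close> the image \<open>(u, v)\<close> of the point has \<open>v \<noteq> 0\<close>, and its division sequence is a
  rescaling of the Edwards sequence with \<open>L = (a - d) / (2 (1 - y))\<close>; this amounts to the
  three identities relating \<open>c\<^sup>4\<close>, \<open>s\<^sub>3\<close> and \<open>s\<^sub>4 / c\<close> to \<open>\<kappa>\<close>, \<open>b3\<close> and \<open>b4\<close>. The equation of the Edwards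
  curve enters only through \<open>x\<^sup>2 (a - d y\<^sup>2) = 1 - y\<^sup>2\<close>, which removes \<open>x\<close> from \<open>v\<^sup>2\<close>.
\<close>

lemma edwards_torsion_iff:
  fixes a d x y :: "'a::field"
  assumes two: "(2::'a) \<noteq> 0" and three: "(3::'a) \<noteq> 0" and ad: "a \<noteq> d"
    and E: "(x, y) \<in> edwards_curve a d" and P: "(x, y) \<noteq> (0, 1)" and n: "n \<ge> 1"
  shows "edwards_torsion a d n (x, y) \<longleftrightarrow> (if even n then y + 1 else 1) * edwards_eds a d y n = 0"
proof (cases "y = -1")
  case True
  then show ?thesis using edwards_torsion_iff_minus_one[OF two ad] E by blast
next
  case False
  have curve: "x^2 * (a - d * y^2) = (1 - y) * (1 + y)"
    using E by (simp add: edwards_curve_def algebra_simps power2_eq_square)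
  have y1: "1 + y \<noteq> 0" using False by (metis add_eq_0_iff)
  have z: "1 - y \<noteq> 0"
  proof
    assume "1 - y = 0"
    then have y: "y = 1" by simp
    then have "x^2 * (a - d) = 0" using curve by simp
    then show False using ad P y by simp
  qed
  have x: "x \<noteq> 0" using curve y1 z by auto
  have num: "(4::'a) = 2 * 2" "(12::'a) = 2 * 2 * 3" "(48::'a) = 2 * 2 * 2 * 2 * 3" by simp_all
  have nz: "(4::'a) \<noteq> 0" "(12::'a) \<noteq> 0" "(48::'a) \<noteq> 0"
    using two three unfolding num mult_eq_0_iff by simp_all
  define \<delta> where "\<delta> = a - d"
  \<comment> \<open>Powers of \<open>i\<close> take the place of all denominators, so that \<open>\<gamma>\<close>, \<open>\<beta>\<close> and \<open>c\<^sup>4\<close> become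
    polynomials in \<open>i\<close>, \<open>y\<close>, \<open>a\<close>, \<open>d\<close>.\<close>
  define i where "i = 1 / (2 * (1 - y))"
  define N where "N = (5 * a - d) + (a - 5 * d) * y"
  define G where "G = (1 + y) * (a - d * y^2)"
  define H where "H = 2 * a + \<delta> * y - 2 * d * y^2"
  define b3 where "b3 = - d * y^4 - 2 * d * y^3 + 2 * a * y + a"
  define b4 where "b4 = - 2 * y * (d * y^4 - a)"
  define A where "A = edwards_A a d"
  define u where "u = N / (12 * (1 - y))"
  define v where "v = \<delta> * (1 + y) / (4 * x * (1 - y))"
  have \<delta>: "\<delta> \<noteq> 0" using ad by (simp add: \<delta>_def)
  have i: "2 * (1 - y) * i = 1" "i \<noteq> 0" using two z by (simp_all add: i_def)
  have v_nz: "v \<noteq> 0" using \<delta> y1 x z nz by (simp add: v_def)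
  have u: "6 * u = N * i"
  proof -
    have "12 * (1 - y) * (6 * u) = 6 * N" using z nz by (simp add: u_def)
    also have "\<dots> = 6 * N * (2 * (1 - y) * i)" unfolding i(1) by simp
    also have "\<dots> = 12 * (1 - y) * (N * i)" by (simp add: mult_ac)
    finally show ?thesis using z nz by simp
  qed
  have H: "3 * u^2 + A = \<delta> * H * i^2"
  proof -
    have "48 * (3 * u^2 + A) = 4 * (6 * u)^2 + 48 * A"
      by (simp add: power2_eq_square algebra_simps)
    also have "48 * A = - (a^2 + 14 * a * d + d^2) * (2 * (1 - y) * i)^2"
      using nz unfolding i(1) by (simp add: A_def edwards_A_def)
    also have "4 * (6 * u)^2 + \<dots> = 4 * i^2 * (N^2 - (a^2 + 14 * a * d + d^2) * (1 - y)^2)"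
      unfolding u by (simp add: power2_eq_square algebra_simps)
    also have "N^2 - (a^2 + 14 * a * d + d^2) * (1 - y)^2 = 12 * (\<delta> * H)"
      by (simp add: N_def H_def \<delta>_def power2_eq_square algebra_simps)
    finally have "48 * (3 * u^2 + A) = 48 * (\<delta> * H * i^2)" by simp
    then show ?thesis unfolding mult_left_cancel[OF nz(3)] .
  qed
  have G: "2 * v^2 = \<delta>^2 * G * i^3"
  proof -
    have "4 * x * (1 - y) * v = \<delta> * (1 + y)"
      using nz x z by (simp add: v_def)
    also have "\<dots> = \<delta> * (1 + y) * (2 * (1 - y) * i)"
      unfolding i(1) by simp
    finally have "2 * (1 - y) * (2 * x * v) = 2 * (1 - y) * (\<delta> * (1 + y) * i)"
      by (simp add: mult_ac)
    then have xv: "2 * x * v = \<delta> * (1 + y) * i" using two z by simp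
    have "2 * 2 * ((1 - y) * (1 + y)) * v^2 = (2 * x * v)^2 * (a - d * y^2)"
      unfolding curve[symmetric] by (simp only: power2_eq_square mult_ac)
    also have "\<dots> = (1 + y) * (\<delta>^2 * G * i^2)"
      unfolding xv by (simp add: G_def power2_eq_square mult_ac)
    also have "\<dots> = (1 + y) * (\<delta>^2 * G * i^2) * (2 * (1 - y) * i)"
      unfolding i(1) by simp
    finally have "(2 * (1 - y) * (1 + y)) * (2 * v^2) = (2 * (1 - y) * (1 + y)) * (\<delta>^2 * G * i^3)"
      by (simp only: power2_eq_square power3_eq_cube mult_ac)
    moreover have "2 * (1 - y) * (1 + y) \<noteq> 0" using two z y1 by simp
    ultimately show ?thesis using mult_left_cancel by blast
  qed
  define c where "c = 2 * v"
  define \<gamma> where "\<gamma> = 6 * u^2 + 2 * A"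
  define \<beta> where "\<beta> = 12 * v^2 * u - (3 * u^2 + A)^2"
  have c: "c \<noteq> 0" using two v_nz by (simp add: c_def)
  have c4: "c^4 = 4 * (\<delta>^2 * G * i^3)^2"
    unfolding G[symmetric] c_def by (simp add: power2_eq_square power4_eq_xxxx)
  have \<gamma>: "\<gamma> = 2 * \<delta> * H * i^2"
    using arg_cong[OF H, of "\<lambda>t. 2 * t"] by (simp add: \<gamma>_def algebra_simps)
  have \<beta>: "\<beta> = \<delta>^3 * i^4 * b3"
  proof -
    have "\<beta> = (2 * v^2) * (6 * u) - (3 * u^2 + A)^2" by (simp add: \<beta>_def)
    also have "\<dots> = \<delta>^2 * i^4 * (G * N - H^2)"
      unfolding G H u by (simp add: power2_eq_square power3_eq_cube power4_eq_xxxx algebra_simps)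
    also have "G * N - H^2 = \<delta> * b3"
      by (simp add: G_def N_def H_def \<delta>_def b3_def power2_eq_square power3_eq_cube power4_eq_xxxx algebra_simps)
    finally show ?thesis by (simp add: power2_eq_square power3_eq_cube)
  qed
  have b4: "\<gamma> * \<beta> - c^4 = \<delta>^5 * i^6 * b4"
  proof -
    have "\<gamma> * \<beta> - c^4 = \<delta>^4 * i^6 * (2 * H * b3 - 4 * G^2)"
      unfolding \<gamma> \<beta> c4 by (simp add: algebra_simps eval_nat_numeral)
    also have "2 * H * b3 - 4 * G^2 = \<delta> * b4"
      by (simp add: G_def H_def \<delta>_def b3_def b4_def algebra_simps eval_nat_numeral)
    finally show ?thesis by (simp add: eval_nat_numeral)
  qed
  have s1: "c^4 * \<delta>^2 = (\<delta> * i)^6 * (4 * (a - d * y^2)^2 * (y + 1)^2)"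
    unfolding c4 G_def by (simp add: power_mult_distrib add.commute mult_ac flip: power_mult power_add)
  have s2: "\<beta> * \<delta> = (\<delta> * i)^4 * b3"
    unfolding \<beta> by (simp add: power_mult_distrib eval_nat_numeral mult_ac)
  have s3: "(\<gamma> * \<beta> - c^4) * \<delta> = (\<delta> * i)^6 * b4"
    unfolding b4 by (simp add: power_mult_distrib eval_nat_numeral mult_ac)
  have "\<delta> * i \<noteq> 0" using \<delta> i by simp
  from eds_scaling[OF \<delta> this s1 s2 s3, of n] obtain \<rho> where
    \<rho>: "\<rho> \<noteq> 0" "eds 1 (c^4) \<beta> (\<gamma> * \<beta> - c^4) n = \<rho> * edwards_eds a d y n"
    by (auto simp: edwards_eds_def \<delta>_def b3_def b4_def)
  obtain m where m: "n = m + 1" using n by (metis add.commute le_Suc_ex)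
  have "edwards_to_weierstrass a d (x, y) = WPt u v"
    using x z by (simp add: edwards_to_weierstrass_def u_def v_def N_def \<delta>_def)
  then have "edwards_torsion a d n (x, y) \<longleftrightarrow> weierstrass_mult A (m + 1) (WPt u v) = WInf"
    by (simp add: edwards_torsion_def A_def m)
  also have "\<dots> \<longleftrightarrow> division_seq c \<beta> \<gamma> n = 0"
    unfolding weierstrass_mult_division_seq[OF two v_nz] m c_def \<gamma>_def \<beta>_def by simp
  also have "\<dots> \<longleftrightarrow> edwards_eds a d y n = 0"
    using c \<rho> by (simp add: division_seq_def)
  finally show ?thesis using y1 by (simp add: add.commute)
qed

theorem corollary6p2:
  fixes a d :: "'k::field" and x y :: "'k alg_closure" and n :: nat
  assumes "CHAR('k) \<noteq> 2" and "CHAR('k) \<noteq> 3"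
    and "a \<noteq> 0" and "d \<noteq> 0" and "a \<noteq> d"
    and "(x, y) \<in> edwards_curve (to_ac a) (to_ac d)" and "(x, y) \<noteq> (0, 1)"
    and "n \<ge> 1"
  shows "edwards_torsion (to_ac a) (to_ac d) n (x, y) \<longleftrightarrow>
         poly (map_poly to_ac (edwards_psi_poly a d n)) y = 0"
proof -
  have char: "of_nat p \<noteq> (0 :: 'k alg_closure)" if "prime p" "CHAR('k) \<noteq> p" for p
  proof
    assume "of_nat p = (0 :: 'k alg_closure)"
    then have "CHAR('k) dvd p" by (simp add: of_nat_eq_0_iff_char_dvd)
    then have "CHAR('k) = 1 \<or> CHAR('k) = p" using that(1) unfolding prime_nat_iff by blast
    then show False using that(2) CHAR_not_1'[where 'a = 'k] by simp
  qed
  have "(2 :: 'k alg_closure) \<noteq> 0" "(3 :: 'k alg_closure) \<noteq> 0"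
    using char[of 2] char[of 3] assms(1,2) by simp_all
  then show ?thesis
    unfolding poly_edwards_psi using edwards_torsion_iff assms(5-8) by (metis to_ac_eq_iff)
qed

end
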